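(* Let $K$ be a Henselian valued field of equicharacteristic zero. Let $A \subset K^{n}$ and let $f: A \to \mathbb{P}^{1}(K)$ be an $\mathcal{L}$-definable function. Then $f$ is piecewise continuous, i.e. there is a finite partition of $A$ into $\mathcal{L}$-definable locally closed subsets $A_{1},\ldots,A_{s}$ of $K^{n}$ such that the restriction of $f$ to each $A_{i}$ is continuous.
   Context: $K$ is a Henselian valued field whose residue field $\Bbbk$ has characteristic zero, with valuation $v$, value group $\Gamma$ and valuation ring $R$. $\mathcal{L}$ is the three-sorted language of Denef--Pas: the $K$-sort carries the language of rings; the $\Gamma$-sort (with $\infty$) carries any augmentation of the language of ordered abelian groups; the $\Bbbk$-sort carries any augmentation of the language of rings; the only symbols connecting the sorts are the valuation $v: K \to \Gamma\cup\{\infty\}$ and a fixed angular component map $\overline{ac}: K \to \Bbbk$ (multiplicative on $K^{\times}$, equal to the residue map on $R^{\times}$, with $\overline{ac}(0)=0$). $\mathcal{L}$-definable means definable in this structure with parameters. Topological notions refer to the $K$-topology (induced by $v$; product topology on $K^{n}$); $\mathbb{P}^{1}(K)$ carries the topology and definable structure obtained by gluing its two affine charts $K$. *)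

theory Defs
  imports "HOL-Analysis.Analysis" "HOL-Computational_Algebra.Polynomial"
begin

datatype 'g vinf = Fin 'g | Infty

instantiation vinf :: (linorder) linorder
begin

fun less_eq_vinf :: "'a vinf \<Rightarrow> 'a vinf \<Rightarrow> bool" where
  "Fin x \<le> Fin y \<longleftrightarrow> x \<le> y"
| "z \<le> Infty \<longleftrightarrow> True"
| "Infty \<le> Fin y \<longleftrightarrow> False"

definition less_vinf :: "'a vinf \<Rightarrow> 'a vinf \<Rightarrow> bool" where
  "x < y \<longleftrightarrow> x \<le> y \<and> \<not> y \<le> x" for x y :: "'a vinf"

instance
proof
  fix x y z :: "'a vinf"
  show "x < y \<longleftrightarrow> x \<le> y \<and> \<not> y \<le> x" by (rule less_vinf_def)
  show "x \<le> x" by (cases x) auto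
  show "x \<le> y \<Longrightarrow> y \<le> z \<Longrightarrow> x \<le> z" by (cases x; cases y; cases z) auto
  show "x \<le> y \<Longrightarrow> y \<le> x \<Longrightarrow> x = y" by (cases x; cases y) auto
  show "x \<le> y \<or> y \<le> x" by (cases x; cases y) auto
qed

end

lemma less_vinf_simps [simp]:
  "Fin x < Fin y \<longleftrightarrow> x < y" "Fin x < Infty" "\<not> Infty < z"
  by (auto simp: less_vinf_def)

instantiation vinf :: (comm_monoid_add) comm_monoid_add
begin

definition zero_vinf :: "'a vinf" where "0 = Fin 0"

fun plus_vinf :: "'a vinf \<Rightarrow> 'a vinf \<Rightarrow> 'a vinf" where
  "Fin x + Fin y = Fin (x + y)"
| "Infty + z = Infty"
| "Fin x + Infty = Infty"

instance
proof
  fix x y z :: "'a vinf"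
  show "x + y + z = x + (y + z)" by (cases x; cases y; cases z) (auto simp: add.assoc)
  show "x + y = y + x" by (cases x; cases y) (auto simp: add.commute)
  show "0 + x = x" by (cases x) (auto simp: zero_vinf_def)
qed

end

text \<open>The type \<open>'g\<close> is the value group itself, so valuations are required to be onto
  \<open>\<Gamma> \<union> {\<infinity>}\<close>. Trivial valuations are allowed.\<close>

definition valuation :: "('k::field \<Rightarrow> 'g::linordered_ab_group_add vinf) \<Rightarrow> bool" where
  "valuation v \<longleftrightarrow>
     (\<forall>x. v x = Infty \<longleftrightarrow> x = 0) \<and>
     (\<forall>x y. v (x * y) = v x + v y) \<and>
     (\<forall>x y. min (v x) (v y) \<le> v (x + y)) \<and>
     surj v"

definition valuation_ring :: "('k::field \<Rightarrow> 'g::linordered_ab_group_add vinf) \<Rightarrow> 'k set" where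
  "valuation_ring v = {x. 0 \<le> v x}"

definition maximal_ideal :: "('k::field \<Rightarrow> 'g::linordered_ab_group_add vinf) \<Rightarrow> 'k set" where
  "maximal_ideal v = {x. 0 < v x}"

definition valuation_units :: "('k::field \<Rightarrow> 'g::linordered_ab_group_add vinf) \<Rightarrow> 'k set" where
  "valuation_units v = {x. v x = 0}"

definition henselian :: "('k::field \<Rightarrow> 'g::linordered_ab_group_add vinf) \<Rightarrow> bool" where
  "henselian v \<longleftrightarrow>
     (\<forall>p a. (\<forall>i. coeff p i \<in> valuation_ring v) \<and> a \<in> valuation_ring v \<and>
            poly p a \<in> maximal_ideal v \<and> poly (pderiv p) a \<in> valuation_units v \<longrightarrow>
            (\<exists>b \<in> valuation_ring v. poly p b = 0 \<and> b - a \<in> maximal_ideal v))"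

text \<open>The type \<open>'r\<close> is presented as the residue field through a surjective ring homomorphism
  from the valuation ring whose kernel is the maximal ideal. The values of \<open>res\<close> outside the
  valuation ring are irrelevant.\<close>

definition residue_map ::
  "('k::field \<Rightarrow> 'g::linordered_ab_group_add vinf) \<Rightarrow> ('k \<Rightarrow> 'r::field) \<Rightarrow> bool" where
  "residue_map v res \<longleftrightarrow>
     res 1 = 1 \<and>
     (\<forall>x \<in> valuation_ring v. \<forall>y \<in> valuation_ring v.
        res (x + y) = res x + res y \<and> res (x * y) = res x * res y) \<and>
     res ` valuation_ring v = UNIV \<and>
     {x \<in> valuation_ring v. res x = 0} = maximal_ideal v"

definition angular_component ::
  "('k::field \<Rightarrow> 'g::linordered_ab_group_add vinf) \<Rightarrow> ('k \<Rightarrow> 'r::field) \<Rightarrow> ('k \<Rightarrow> 'r) \<Rightarrow> bool" where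
  "angular_component v res ac \<longleftrightarrow>
     ac 0 = 0 \<and>
     (\<forall>x y. x \<noteq> 0 \<and> y \<noteq> 0 \<longrightarrow> ac (x * y) = ac x * ac y) \<and>
     (\<forall>x \<in> valuation_units v. ac x = res x)"

text \<open>The types \<open>'gf, 'gp\<close> (respectively \<open>'rf, 'rp\<close>) name the additional function and
  relation symbols on the value group (respectively residue field) sort. As usual for untyped
  first-order terms, a name applied to \<open>m\<close> arguments stands for an \<open>m\<close>-ary symbol, i.e. symbols are
  pairs of a name and an arity; constants are the case \<open>m = 0\<close>. A language whose symbols have
  one fixed arity each is covered by interpreting the other arities by constants, which does not
  change the definable sets.\<close>

datatype kterm =
    KVar nat
  | KZero
  | KOne
  | KAdd kterm kterm
  | KUminus kterm
  | KMult kterm kterm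

datatype 'gf gterm =
    GVar nat
  | GZero
  | GInfty
  | GAdd "'gf gterm" "'gf gterm"
  | GUminus "'gf gterm"
  | GVal kterm
  | GFun 'gf "'gf gterm list"

datatype 'rf rterm =
    RVar nat
  | RZero
  | ROne
  | RAdd "'rf rterm" "'rf rterm"
  | RUminus "'rf rterm"
  | RMult "'rf rterm" "'rf rterm"
  | RAc kterm
  | RFun 'rf "'rf rterm list"

datatype ('gf, 'gp, 'rf, 'rp) formula =
    KEq kterm kterm
  | GEq "'gf gterm" "'gf gterm"
  | GLess "'gf gterm" "'gf gterm"
  | GRel 'gp "'gf gterm list"
  | REq "'rf rterm" "'rf rterm"
  | RRel 'rp "'rf rterm list"
  | Neg "('gf, 'gp, 'rf, 'rp) formula"
  | Conj "('gf, 'gp, 'rf, 'rp) formula" "('gf, 'gp, 'rf, 'rp) formula"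
  | KEx nat "('gf, 'gp, 'rf, 'rp) formula"
  | GEx nat "('gf, 'gp, 'rf, 'rp) formula"
  | REx nat "('gf, 'gp, 'rf, 'rp) formula"

record ('k, 'g, 'r, 'gf, 'gp, 'rf, 'rp) pas_structure =
  val :: "'k \<Rightarrow> 'g vinf"
  ac :: "'k \<Rightarrow> 'r"
  gfun :: "'gf \<Rightarrow> 'g vinf list \<Rightarrow> 'g vinf"
  grel :: "'gp \<Rightarrow> 'g vinf list \<Rightarrow> bool"
  rfun :: "'rf \<Rightarrow> 'r list \<Rightarrow> 'r"
  rrel :: "'rp \<Rightarrow> 'r list \<Rightarrow> bool"

primrec eval_k :: "(nat \<Rightarrow> 'k::field) \<Rightarrow> kterm \<Rightarrow> 'k" where
  "eval_k x (KVar i) = x i"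
| "eval_k x KZero = 0"
| "eval_k x KOne = 1"
| "eval_k x (KAdd s t) = eval_k x s + eval_k x t"
| "eval_k x (KUminus t) = - eval_k x t"
| "eval_k x (KMult s t) = eval_k x s * eval_k x t"

text \<open>Convention: \<open>-\<infinity> = \<infinity>\<close>.\<close>

primrec eval_g ::
  "('k::field, 'g::linordered_ab_group_add, 'r::field, 'gf, 'gp, 'rf, 'rp) pas_structure \<Rightarrow>
   (nat \<Rightarrow> 'k) \<Rightarrow> (nat \<Rightarrow> 'g vinf) \<Rightarrow> 'gf gterm \<Rightarrow> 'g vinf" where
  "eval_g M x g (GVar i) = g i"
| "eval_g M x g GZero = 0"
| "eval_g M x g GInfty = Infty"
| "eval_g M x g (GAdd s t) = eval_g M x g s + eval_g M x g t"
| "eval_g M x g (GUminus t) = map_vinf uminus (eval_g M x g t)"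
| "eval_g M x g (GVal t) = val M (eval_k x t)"
| "eval_g M x g (GFun F ts) = gfun M F (map (eval_g M x g) ts)"

primrec eval_r ::
  "('k::field, 'g::linordered_ab_group_add, 'r::field, 'gf, 'gp, 'rf, 'rp) pas_structure \<Rightarrow>
   (nat \<Rightarrow> 'k) \<Rightarrow> (nat \<Rightarrow> 'r) \<Rightarrow> 'rf rterm \<Rightarrow> 'r" where
  "eval_r M x r (RVar i) = r i"
| "eval_r M x r RZero = 0"
| "eval_r M x r ROne = 1"
| "eval_r M x r (RAdd s t) = eval_r M x r s + eval_r M x r t"
| "eval_r M x r (RUminus t) = - eval_r M x r t"
| "eval_r M x r (RMult s t) = eval_r M x r s * eval_r M x r t"
| "eval_r M x r (RAc t) = ac M (eval_k x t)"
| "eval_r M x r (RFun F ts) = rfun M F (map (eval_r M x r) ts)"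

primrec sat ::
  "('k::field, 'g::linordered_ab_group_add, 'r::field, 'gf, 'gp, 'rf, 'rp) pas_structure \<Rightarrow>
   (nat \<Rightarrow> 'k) \<Rightarrow> (nat \<Rightarrow> 'g vinf) \<Rightarrow> (nat \<Rightarrow> 'r) \<Rightarrow> ('gf, 'gp, 'rf, 'rp) formula \<Rightarrow> bool" where
  "sat M x g r (KEq s t) \<longleftrightarrow> eval_k x s = eval_k x t"
| "sat M x g r (GEq s t) \<longleftrightarrow> eval_g M x g s = eval_g M x g t"
| "sat M x g r (GLess s t) \<longleftrightarrow> eval_g M x g s < eval_g M x g t"
| "sat M x g r (GRel P ts) \<longleftrightarrow> grel M P (map (eval_g M x g) ts)"
| "sat M x g r (REq s t) \<longleftrightarrow> eval_r M x r s = eval_r M x r t"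
| "sat M x g r (RRel P ts) \<longleftrightarrow> rrel M P (map (eval_r M x r) ts)"
| "sat M x g r (Neg \<phi>) \<longleftrightarrow> \<not> sat M x g r \<phi>"
| "sat M x g r (Conj \<phi> \<psi>) \<longleftrightarrow> sat M x g r \<phi> \<and> sat M x g r \<psi>"
| "sat M x g r (KEx i \<phi>) \<longleftrightarrow> (\<exists>a. sat M (x(i := a)) g r \<phi>)"
| "sat M x g r (GEx i \<phi>) \<longleftrightarrow> (\<exists>a. sat M x (g(i := a)) r \<phi>)"
| "sat M x g r (REx i \<phi>) \<longleftrightarrow> (\<exists>a. sat M x g (r(i := a)) \<phi>)"

text \<open>Points of \<open>K\<^sup>n\<close> are the functions on \<open>{..<n}\<close>, extended by \<open>undefined\<close>.\<close>

definition Kpow :: "nat \<Rightarrow> (nat \<Rightarrow> 'k) set" where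
  "Kpow n = {..<n} \<rightarrow>\<^sub>E UNIV"

text \<open>The parameters are the values \<open>a i\<close> (\<open>i \<ge> n\<close>), \<open>g i\<close>, \<open>r i\<close> of the variables other than the
  \<open>n\<close> coordinates.\<close>

definition definable ::
  "('k::field, 'g::linordered_ab_group_add, 'r::field, 'gf, 'gp, 'rf, 'rp) pas_structure \<Rightarrow>
   nat \<Rightarrow> (nat \<Rightarrow> 'k) set \<Rightarrow> bool" where
  "definable M n S \<longleftrightarrow>
     (\<exists>\<phi> a g r. S = {x \<in> Kpow n. sat M (\<lambda>i. if i < n then x i else a i) g r \<phi>})"

definition K_topology :: "('k::field \<Rightarrow> 'g::linordered_ab_group_add vinf) \<Rightarrow> 'k topology" where
  "K_topology v = topology (\<lambda>U. \<forall>x\<in>U. \<exists>\<gamma>. {y. Fin \<gamma> < v (y - x)} \<subseteq> U)"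

lemma openin_K_topology:
  "openin (K_topology v) U \<longleftrightarrow> (\<forall>x\<in>U. \<exists>\<gamma>. {y. Fin \<gamma> < v (y - x)} \<subseteq> U)"
proof -
  have "istopology (\<lambda>U. \<forall>x\<in>U. \<exists>\<gamma>. {y. Fin \<gamma> < v (y - x)} \<subseteq> U)"
    unfolding istopology_def
  proof (intro conjI allI impI ballI)
    fix S T x
    assume "\<forall>x\<in>S. \<exists>\<gamma>. {y. Fin \<gamma> < v (y - x)} \<subseteq> S" "\<forall>x\<in>T. \<exists>\<gamma>. {y. Fin \<gamma> < v (y - x)} \<subseteq> T"
      and "x \<in> S \<inter> T"
    then obtain \<gamma> \<delta> where *: "{y. Fin \<gamma> < v (y - x)} \<subseteq> S" "{y. Fin \<delta> < v (y - x)} \<subseteq> T"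
      by blast
    have "Fin \<gamma> \<le> Fin (max \<gamma> \<delta>)" "Fin \<delta> \<le> Fin (max \<gamma> \<delta>)"
      by auto
    with * have "{y. Fin (max \<gamma> \<delta>) < v (y - x)} \<subseteq> S \<inter> T"
      by (blast dest: le_less_trans)
    then show "\<exists>\<gamma>. {y. Fin \<gamma> < v (y - x)} \<subseteq> S \<inter> T" ..
  next
    fix \<K> x
    assume "\<forall>U\<in>\<K>. \<forall>x\<in>U. \<exists>\<gamma>. {y. Fin \<gamma> < v (y - x)} \<subseteq> U" and "x \<in> \<Union>\<K>"
    then show "\<exists>\<gamma>. {y. Fin \<gamma> < v (y - x)} \<subseteq> \<Union>\<K>"
      by (meson Union_iff Union_upper order_trans)
  qed
  then show ?thesis
    unfolding K_topology_def by (simp add: topology_inverse')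
qed

lemma topspace_K_topology [simp]: "topspace (K_topology v) = UNIV"
proof -
  have "openin (K_topology v) UNIV"
    by (simp add: openin_K_topology)
  then show ?thesis
    by (meson openin_subset top.extremum_uniqueI)
qed

definition Kpow_topology ::
  "('k::field \<Rightarrow> 'g::linordered_ab_group_add vinf) \<Rightarrow> nat \<Rightarrow> (nat \<Rightarrow> 'k) topology" where
  "Kpow_topology v n = product_topology (\<lambda>_. K_topology v) {..<n}"

lemma topspace_Kpow_topology [simp]: "topspace (Kpow_topology v n) = Kpow n"
  by (simp add: Kpow_topology_def Kpow_def)

definition locally_closed_in :: "'a topology \<Rightarrow> 'a set \<Rightarrow> bool" where
  "locally_closed_in X S \<longleftrightarrow> (\<exists>U C. openin X U \<and> closedin X C \<and> S = U \<inter> C)"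

definition proj1_rel :: "'k::field \<times> 'k \<Rightarrow> 'k \<times> 'k \<Rightarrow> bool" where
  "proj1_rel p q \<longleftrightarrow>
     p \<noteq> (0, 0) \<and> q \<noteq> (0, 0) \<and> (\<exists>c. c \<noteq> 0 \<and> fst q = c * fst p \<and> snd q = c * snd p)"

lemma part_equivp_proj1_rel: "part_equivp (proj1_rel :: 'k::field \<times> 'k \<Rightarrow> 'k \<times> 'k \<Rightarrow> bool)"
proof (rule part_equivpI)
  show "\<exists>p :: 'k \<times> 'k. proj1_rel p p"
    by (rule exI[of _ "(1, 1)"]) (auto simp: proj1_rel_def)
  show "symp (proj1_rel :: 'k \<times> 'k \<Rightarrow> _)"
  proof (rule sympI)
    fix p q :: "'k \<times> 'k"
    assume "proj1_rel p q"
    then obtain c where "p \<noteq> (0, 0)" "q \<noteq> (0, 0)" "c \<noteq> 0" "fst q = c * fst p" "snd q = c * snd p"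
      by (auto simp: proj1_rel_def)
    then show "proj1_rel q p"
      unfolding proj1_rel_def by (intro conjI exI[of _ "inverse c"]) auto
  qed
  show "transp (proj1_rel :: 'k \<times> 'k \<Rightarrow> _)"
  proof (rule transpI)
    fix p q s :: "'k \<times> 'k"
    assume "proj1_rel p q" "proj1_rel q s"
    then obtain c d where "p \<noteq> (0, 0)" "s \<noteq> (0, 0)" "c \<noteq> 0" "d \<noteq> 0"
      "fst q = c * fst p" "snd q = c * snd p" "fst s = d * fst q" "snd s = d * snd q"
      by (auto simp: proj1_rel_def)
    then show "proj1_rel p s"
      unfolding proj1_rel_def by (intro conjI exI[of _ "d * c"]) auto
  qed
qed

quotient_type (overloaded) 'k proj1 = "'k::field \<times> 'k" / partial: proj1_rel
  by (rule part_equivp_proj1_rel)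

definition chart0 :: "'k::field \<Rightarrow> 'k proj1" where
  "chart0 t = abs_proj1 (1, t)"

definition chart1 :: "'k::field \<Rightarrow> 'k proj1" where
  "chart1 t = abs_proj1 (t, 1)"

lemma abs_proj1_eq_iff:
  assumes "p \<noteq> (0, 0)" "q \<noteq> (0, 0)"
  shows "abs_proj1 p = abs_proj1 q \<longleftrightarrow> proj1_rel p q"
proof -
  have "proj1_rel p p" "proj1_rel q q"
    using assms by (auto simp: proj1_rel_def intro!: exI[of _ 1])
  then show ?thesis
    using Quotient3_rel[OF Quotient3_proj1] by metis
qed

lemma inj_charts: "inj chart0" "inj chart1"
  by (auto simp: inj_def chart0_def chart1_def abs_proj1_eq_iff proj1_rel_def)

lemma charts_cover: "range chart0 \<union> range chart1 = UNIV"
proof -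
  have "z \<in> range chart0 \<union> range chart1" for z :: "'k::field proj1"
  proof -
    obtain p where p: "proj1_rel p p" "z = abs_proj1 p"
      by (metis Quotient3_abs_rep[OF Quotient3_proj1] Quotient3_rep_reflp[OF Quotient3_proj1])
    obtain a b where ab: "p = (a, b)" by (cases p)
    show ?thesis
    proof (cases "a = 0")
      case False
      then have "z = chart0 (b / a)"
        using p ab by (auto simp: chart0_def abs_proj1_eq_iff proj1_rel_def intro!: exI[of _ "inverse a"] simp: field_simps)
      then show ?thesis by simp
    next
      case True
      then have "b \<noteq> 0" using p ab by (auto simp: proj1_rel_def)
      then have "z = chart1 (a / b)"
        using p ab by (auto simp: chart1_def abs_proj1_eq_iff proj1_rel_def intro!: exI[of _ "inverse b"] simp: field_simps)
      then show ?thesis by simp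
    qed
  qed
  then show ?thesis by blast
qed

lemma charts_transition: "chart0 s = chart1 t \<longleftrightarrow> s * t = 1"
  by (auto simp: chart0_def chart1_def abs_proj1_eq_iff proj1_rel_def mult.commute)

definition proj1_topology ::
  "('k::field \<Rightarrow> 'g::linordered_ab_group_add vinf) \<Rightarrow> 'k proj1 topology" where
  "proj1_topology v =
     topology (\<lambda>U. openin (K_topology v) (chart0 -` U) \<and> openin (K_topology v) (chart1 -` U))"

lemma openin_proj1_topology:
  "openin (proj1_topology v) U \<longleftrightarrow>
     openin (K_topology v) (chart0 -` U) \<and> openin (K_topology v) (chart1 -` U)"
proof -
  have "istopology
    (\<lambda>U. openin (K_topology v) (chart0 -` U) \<and> openin (K_topology v) (chart1 -` U))"
    unfolding istopology_def vimage_Int vimage_Union by auto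
  then show ?thesis
    unfolding proj1_topology_def by (simp add: topology_inverse')
qed

lemma topspace_proj1_topology [simp]: "topspace (proj1_topology v) = UNIV"
proof -
  have "openin (proj1_topology v) UNIV"
    using openin_topspace[of "K_topology v"] by (simp add: openin_proj1_topology)
  then show ?thesis
    by (meson openin_subset top.extremum_uniqueI)
qed

definition definable_in_Kpow_proj1 ::
  "('k::field, 'g::linordered_ab_group_add, 'r::field, 'gf, 'gp, 'rf, 'rp) pas_structure \<Rightarrow>
   nat \<Rightarrow> ((nat \<Rightarrow> 'k) \<times> 'k proj1) set \<Rightarrow> bool" where
  "definable_in_Kpow_proj1 M n S \<longleftrightarrow>
     S \<subseteq> Kpow n \<times> UNIV \<and>
     (\<forall>chart \<in> {chart0, chart1}.
        definable M (Suc n) {z \<in> Kpow (Suc n). (restrict z {..<n}, chart (z n)) \<in> S})"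

text \<open>A function is definable if its graph is; this entails that its domain \<open>A\<close> is a definable
  subset of \<open>K\<^sup>n\<close>. The values of \<open>f\<close> outside \<open>A\<close> are irrelevant.\<close>

definition definable_to_proj1 ::
  "('k::field, 'g::linordered_ab_group_add, 'r::field, 'gf, 'gp, 'rf, 'rp) pas_structure \<Rightarrow>
   nat \<Rightarrow> (nat \<Rightarrow> 'k) set \<Rightarrow> ((nat \<Rightarrow> 'k) \<Rightarrow> 'k proj1) \<Rightarrow> bool" where
  "definable_to_proj1 M n A f \<longleftrightarrow> definable_in_Kpow_proj1 M n {(x, f x) | x. x \<in> A}"

end

(*
  Field quantifiers are eliminated by hand: write rv x = rv y when x = y or v(x - y) > v(x); on
  nonzero elements this is equality of (v, ac).  For a finite set of polynomials p(y), any y has a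
  centre c, either 0 or a root of a derivative of some p, such that no Taylor expansion at c cancels
  at y: if one does, Hensel's lemma produces a root of a derivative closer to y.  Then rv p(y) is a
  function of rv(y - c) and of the rv of the Taylor coefficients at c, and induction on degrees,
  reducing modulo an equation for c, yields finitely many polynomials q(x) whose rv decide which
  tuples rv p(x, y) occur.  The witness y moves continuously with x along points x' with
  rv q(x') = rv q(x).  For the graph of f, the witness over x' is f(x').  On a set where the vanishing
  pattern of the q is constant, every rv q is locally constant, so there the domain of f is
  relatively open and f is continuous; such sets are locally closed.
*)

theory Submission
  imports Defs
begin

section \<open>Valuations and leading terms\<close>

text \<open>No formula is rewritten into a quantifier-free one. What is proved is an invariance:
  truth depends on the field variables only through the leading terms of finitely many polynomials,
  with the variables of the other sorts held fixed. This is why arbitrary extra structure on those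
  sorts does no harm. The obstacle is that a centre is a root and not the value of a term in x, so
  it has to be carried to x' together with y. Carrying a root of f needs an expansion of the
  derivative of f without cancellation; the derivative has smaller degree, so its centre comes from
  the induction. Conditions of higher degree would need centres of higher degree, hence the
  reduction modulo f. Continuity travels through the same induction. Hensel's lemma gives a root at
  a known distance from the approximation, so a moved root is controlled by the value of f at the
  approximation, up to a fixed constant \<epsilon>. Stating this for filters lets one induction
  serve both quantifier elimination and continuity.\<close>

instance vinf :: (linordered_ab_group_add) ordered_comm_monoid_add
proof
  fix a b c :: "'a vinf"
  show "a \<le> b \<Longrightarrow> c + a \<le> c + b"
    by (cases a; cases b; cases c) auto
qed

lemma vinf_add_strict_left_mono:
  "c \<noteq> Infty \<Longrightarrow> a < b \<Longrightarrow> c + a < c + b" for a b c :: "'a::linordered_ab_group_add vinf"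
  by (cases a; cases b; cases c) auto

lemma vinf_add_less_cancel:
  "c + a < c + b \<Longrightarrow> a < b" for a b c :: "'a::linordered_ab_group_add vinf"
  by (cases a; cases b; cases c) auto

lemma vinf_le_Infty [simp]: "z \<le> (Infty :: 'a::linorder vinf)"
  by (cases z) auto

lemma Infty_le_iff [simp]: "Infty \<le> (z :: 'a::linorder vinf) \<longleftrightarrow> z = Infty"
  by (cases z) auto

lemma Infty_neq_0 [simp]: "Infty \<noteq> (0 :: 'a::comm_monoid_add vinf)"
  "0 < (Infty :: 'b::linordered_ab_group_add vinf)"
  by (auto simp: zero_vinf_def)

text \<open>The affine substitution takes 0 to \<open>c\<close> and 1 to \<open>c + d\<close>.
  Cancellation at \<open>c + d\<close> becomes cancellation in the sum of the coefficients, and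
  Hensel's lemma gets applied at the unit 1.\<close>

definition zoom :: "'k::field poly \<Rightarrow> 'k \<Rightarrow> 'k \<Rightarrow> 'k poly" where
  "zoom f c d = pcompose f [:c, d:]"

lemma poly_zoom [simp]: "poly (zoom f c d) t = poly f (c + d * t)"
  by (simp add: zoom_def poly_pcompose mult.commute)

lemma higher_pderiv_zoom:
  "(pderiv ^^ i) (zoom f c d) = smult (d ^ i) (zoom ((pderiv ^^ i) f) c d)"
proof (induction i)
  case (Suc i)
  then show ?case
    by (simp add: pderiv_smult pderiv_pcompose zoom_def pderiv_pCons mult.commute)
qed simp

text \<open>Stated with \<open>fact i\<close> on the left to avoid division; once positive integers
  have value 0, this factor is invisible to \<open>v\<close> and cancels from leading terms.\<close>

lemma fact_times_coeff:
  "of_nat (fact i) * coeff p i = poly ((pderiv ^^ i) p) (0 :: 'k::field)"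
proof -
  have "of_nat (fact i) * coeff p i = coeff ((pderiv ^^ i) p) 0"
  proof (induction i arbitrary: p)
    case (Suc i)
    have "of_nat (fact (Suc i)) * coeff p (Suc i) = of_nat (fact i) * coeff (pderiv p) i"
      by (simp add: coeff_pderiv algebra_simps)
    also have "\<dots> = coeff ((pderiv ^^ Suc i) p) 0"
      by (simp add: Suc funpow_Suc_right del: funpow.simps)
    finally show ?case .
  qed simp
  then show ?thesis by (simp add: poly_0_coeff_0)
qed

lemma fact_times_coeff_zoom:
  "of_nat (fact i) * coeff (zoom f c d) i = d ^ i * poly ((pderiv ^^ i) f) c"
  by (simp add: fact_times_coeff higher_pderiv_zoom)

lemma poly_eq_sum_coeff:
  "degree p \<le> n \<Longrightarrow> poly p x = (\<Sum>i\<le>n. coeff p i * x ^ i)" for p :: "'a::comm_semiring_1 poly"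
  unfolding poly_altdef by (rule sum.mono_neutral_left) (auto simp: coeff_eq_0)

lemma higher_pderiv_eq_0:
  fixes p :: "'k::field poly"
  assumes "degree p < m"
  shows "(pderiv ^^ m) p = 0"
  by (rule poly_eqI) (use assms in \<open>simp add: coeff_higher_pderiv coeff_eq_0\<close>)

lemma degree_pderiv_le: "degree (pderiv p) \<le> degree (p :: 'k::field poly) - 1"
  by (rule degree_le) (simp add: coeff_pderiv coeff_eq_0)

section \<open>Arithmetic of a valuation\<close>

locale valued =
  fixes v :: "'k::field \<Rightarrow> 'g::linordered_ab_group_add vinf"
  assumes valuation: "valuation v"
begin

lemma v_eq_Infty_iff [simp]: "v x = Infty \<longleftrightarrow> x = 0"
  and v_mult: "v (x * y) = v x + v y"
  and v_add: "min (v x) (v y) \<le> v (x + y)"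
  using valuation by (auto simp: valuation_def)

lemma v_0 [simp]: "v 0 = Infty" by simp

lemma v_1 [simp]: "v 1 = 0"
proof -
  have "v 1 = v 1 + v 1" using v_mult[of 1 1] by simp
  moreover have "v 1 \<noteq> Infty" by simp
  ultimately show ?thesis by (cases "v 1") (auto simp: zero_vinf_def)
qed

lemma v_minus [simp]: "v (- x) = v x"
proof -
  have "v (-1) + v (-1) = 0" using v_mult[of "-1" "-1"] by simp
  then have "v (-1) = 0" by (cases "v (-1)") (auto simp: zero_vinf_def)
  then show ?thesis using v_mult[of "-1" x] by simp
qed

lemma v_minus_commute: "v (x - y) = v (y - x)"
  using v_minus[of "x - y"] by simp

lemma v_add_ge: "\<gamma> \<le> v x \<Longrightarrow> \<gamma> \<le> v y \<Longrightarrow> \<gamma> \<le> v (x + y)"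
  using v_add[of x y] by (auto simp: min_def split: if_splits)

lemma v_add_gt: "\<gamma> < v x \<Longrightarrow> \<gamma> < v y \<Longrightarrow> \<gamma> < v (x + y)"
  using v_add[of x y] by (auto simp: min_def split: if_splits)

lemma v_diff_ge: "\<gamma> \<le> v x \<Longrightarrow> \<gamma> \<le> v y \<Longrightarrow> \<gamma> \<le> v (x - y)"
  using v_add_ge[of \<gamma> x "- y"] by simp

lemma v_eq_of_diff_gt: "v x < v (x - y) \<Longrightarrow> v y = v x"
proof (rule antisym)
  assume *: "v x < v (x - y)"
  show "v x \<le> v y" using v_diff_ge[of "v x" x "x - y"] * by simp
  show "v y \<le> v x"
  proof (rule ccontr)
    assume "\<not> v y \<le> v x"
    then have "v x < v ((x - y) + y)" using * by (intro v_add_gt) auto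
    then show False by simp
  qed
qed

lemma v_sum_ge: "(\<And>i. i \<in> I \<Longrightarrow> \<gamma> \<le> v (f i)) \<Longrightarrow> \<gamma> \<le> v (sum f I)"
  by (induction I rule: infinite_finite_induct) (auto intro: v_add_ge)

lemma v_sum_gt: "\<gamma> < Infty \<Longrightarrow> (\<And>i. i \<in> I \<Longrightarrow> \<gamma> < v (f i)) \<Longrightarrow> \<gamma> < v (sum f I)"
  by (induction I rule: infinite_finite_induct) (auto intro: v_add_gt)

lemma v_mult_nonneg: "0 \<le> v x \<Longrightarrow> 0 \<le> v y \<Longrightarrow> 0 \<le> v (x * y)"
  unfolding v_mult by (rule add_nonneg_nonneg)

lemma v_mult_pos: "0 < v x \<Longrightarrow> 0 \<le> v y \<Longrightarrow> 0 < v (x * y)"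
  unfolding v_mult by (rule add_pos_nonneg)

lemma v_power_nonneg: "0 \<le> v x \<Longrightarrow> 0 \<le> v (x ^ n)"
  by (induction n) (auto intro: v_mult_nonneg)

lemma v_of_nat_nonneg: "0 \<le> v (of_nat n)"
  by (induction n) (auto intro: v_add_ge)

lemma v_divide_cancel: "s \<noteq> 0 \<Longrightarrow> v x = v s + v (x / s)"
  by (simp flip: v_mult)

lemma v_divide_nonneg: "s \<noteq> 0 \<Longrightarrow> v s \<le> v x \<Longrightarrow> 0 \<le> v (x / s)"
  using v_divide_cancel[of s x] vinf_add_strict_left_mono[of "v s" "v (x / s)" 0]
  by (auto simp: not_less[symmetric])

lemma v_divide_pos: "s \<noteq> 0 \<Longrightarrow> v s < v x \<Longrightarrow> 0 < v (x / s)"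
  using v_divide_cancel[of s x] vinf_add_less_cancel[of "v s" 0 "v (x / s)"] by simp

lemma v_divide_eq: "s \<noteq> 0 \<Longrightarrow> v x = v s \<Longrightarrow> v (x / s) = 0"
  using v_divide_cancel[of s x] by (cases "v s"; cases "v (x / s)") (auto simp: zero_vinf_def)

lemma v_poly_nonneg: "(\<And>i. 0 \<le> v (coeff p i)) \<Longrightarrow> 0 \<le> v a \<Longrightarrow> 0 \<le> v (poly p a)"
  unfolding poly_altdef by (intro v_sum_ge v_mult_nonneg v_power_nonneg)

lemma v_coeff_higher_pderiv_nonneg:
  assumes "\<And>i. 0 \<le> v (coeff p i)"
  shows "0 \<le> v (coeff ((pderiv ^^ m) p) i)"
  using assms
proof (induction m arbitrary: p)
  case (Suc m)
  have "0 \<le> v (coeff (pderiv p) i)" for i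
    unfolding coeff_pderiv by (intro v_mult_nonneg v_of_nat_nonneg Suc.prems)
  then show ?case using Suc.IH by (simp add: funpow_Suc_right del: funpow.simps)
qed auto

text \<open>A second-order Taylor expansion whose remainder stays integral. In \<open>hensel\<close>
  it shows that the factor of \<open>b - a\<close> in \<open>poly p b - poly p a\<close> is a
  unit.\<close>

lemma poly_linear_expansion:
  assumes "\<And>i. 0 \<le> v (coeff p i)" "0 \<le> v a" "0 \<le> v e"
  shows "\<exists>r. 0 \<le> v r \<and> poly p (a + e) = poly p a + e * (poly (pderiv p) a + e * r)"
  using assms(1)
proof (induction p rule: pCons_induct)
  case 0
  show ?case by (intro exI[of _ 0]) auto
next
  case (pCons b p)
  have int: "0 \<le> v (coeff p i)" for i using pCons.prems[of "Suc i"] by simp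
  from pCons.IH[OF this] obtain r where r: "0 \<le> v r"
    "poly p (a + e) = poly p a + e * (poly (pderiv p) a + e * r)" by blast
  have "0 \<le> v (coeff (pderiv p) i)" for i
    using v_coeff_higher_pderiv_nonneg[of p 1 i] int by simp
  then have "0 \<le> v (a * r + poly (pderiv p) a + e * r)"
    using assms r by (intro v_add_ge v_mult_nonneg v_poly_nonneg)
  moreover have "poly (pCons b p) (a + e) = poly (pCons b p) a +
      e * (poly (pderiv (pCons b p)) a + e * (a * r + poly (pderiv p) a + e * r))"
    by (simp add: r(2) pderiv_pCons algebra_simps)
  ultimately show ?case by blast
qed

text \<open>Equality in the quotient of the nonzero elements by 1 + m, with 0 added. The disjunct
  \<open>a = b\<close> matters for \<open>a = b = 0\<close>, where no value exceeds
  \<open>Infty\<close>.\<close>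

definition rv_eq :: "'k \<Rightarrow> 'k \<Rightarrow> bool" where
  "rv_eq a b \<longleftrightarrow> a = b \<or> v a < v (a - b)"

lemma rv_eq_refl [simp]: "rv_eq a a" by (simp add: rv_eq_def)

lemma rv_eq_v: "rv_eq a b \<Longrightarrow> v a = v b"
  unfolding rv_eq_def by (elim disjE) (simp, rule sym, erule v_eq_of_diff_gt)

lemma rv_eq_0_iff: "rv_eq a b \<Longrightarrow> a = 0 \<longleftrightarrow> b = 0"
  using rv_eq_v by (metis v_eq_Infty_iff)

lemma rv_eq_0 [simp]: "rv_eq 0 b \<longleftrightarrow> b = 0" "rv_eq a 0 \<longleftrightarrow> a = 0"
  by (auto dest: rv_eq_0_iff)

lemma rv_eq_sym: "rv_eq a b \<Longrightarrow> rv_eq b a"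
  using rv_eq_v[of a b] v_minus_commute[of a b] by (auto simp: rv_eq_def)

lemma rv_eq_trans: "rv_eq a b \<Longrightarrow> rv_eq b c \<Longrightarrow> rv_eq a c"
proof -
  assume ab: "rv_eq a b" and bc: "rv_eq b c"
  show ?thesis
  proof (cases "a = b \<or> b = c")
    case False
    then have "v a < v (a - b)" "v a < v (b - c)" using ab bc rv_eq_v[OF ab] by (auto simp: rv_eq_def)
    then have "v a < v ((a - b) + (b - c))" by (rule v_add_gt)
    then show ?thesis by (simp add: rv_eq_def)
  qed (use ab bc in auto)
qed

lemma rv_eq_mult_left: "rv_eq a b \<Longrightarrow> rv_eq (c * a) (c * b)"
  using vinf_add_strict_left_mono[of "v c" "v a" "v (a - b)"]
  by (cases "c = 0") (auto simp: rv_eq_def v_mult simp flip: right_diff_distrib)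

lemma rv_eq_mult: "rv_eq a b \<Longrightarrow> rv_eq c d \<Longrightarrow> rv_eq (a * c) (b * d)"
  by (metis rv_eq_mult_left rv_eq_trans mult.commute)

lemma rv_eq_power: "rv_eq a b \<Longrightarrow> rv_eq (a ^ n) (b ^ n)"
  by (induction n) (auto intro: rv_eq_mult)

lemma rv_eq_mult_cancel_left: "rv_eq (c * a) (c * b) \<Longrightarrow> c \<noteq> 0 \<Longrightarrow> rv_eq a b"
  using rv_eq_mult_left[of "c * a" "c * b" "inverse c"] by (simp flip: mult.assoc)

lemma rv_eq_mult_cancel: "rv_eq (c * a) (d * b) \<Longrightarrow> rv_eq c d \<Longrightarrow> c \<noteq> 0 \<Longrightarrow> rv_eq a b"
  by (metis rv_eq_mult rv_eq_refl rv_eq_sym rv_eq_trans rv_eq_mult_cancel_left)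

text \<open>Since \<open>1 + \<mm>\<close> is the kernel of \<open>(v, ac)\<close> on \<open>K\<^sup>\<times>\<close>, formulas see field elements only
  up to \<open>rv_eq\<close>.\<close>

lemma rv_eq_ac:
  assumes "residue_map v res" "angular_component v res acm" "rv_eq a b"
  shows "acm a = acm b"
proof (cases "a = b")
  case False
  then have less: "v a < v (a - b)" using assms(3) by (simp add: rv_eq_def)
  then have a: "a \<noteq> 0" by auto
  with assms(3) have b: "b \<noteq> 0" by (auto dest: rv_eq_0_iff)
  define e where "e = (a - b) / a"
  have e: "0 < v e" unfolding e_def by (rule v_divide_pos[OF a less])
  have unit: "v (b / a) = 0" using a rv_eq_v[OF assms(3)] by (simp add: v_divide_eq)
  have e_ring: "e \<in> valuation_ring v" "b / a \<in> valuation_ring v"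
    using e unit by (auto simp: valuation_ring_def)
  have "e + b / a = 1" using a by (simp add: e_def field_simps)
  then have "res e + res (b / a) = 1"
    using assms(1) e_ring unfolding residue_map_def by (metis (no_types))
  moreover have "res e = 0"
    using assms(1) e unfolding residue_map_def maximal_ideal_def by blast
  ultimately have "res (b / a) = 1" by simp
  then have "acm (b / a) = 1"
    using assms(2) unit by (simp add: angular_component_def valuation_units_def)
  moreover have "acm (x * y) = acm x * acm y" if "x \<noteq> 0" "y \<noteq> 0" for x y
    using assms(2) that by (simp add: angular_component_def)
  from this[of "b / a" a] have "acm (b / a * a) = acm (b / a) * acm a"
    using a b by (metis divide_eq_0_iff)
  ultimately show ?thesis using a by simp
qed simp

end

section \<open>Centres of Taylor expansions\<close>

text \<open>Residue characteristic zero appears as the statement that positive integers have value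
  0, which keeps the residue map out of the polynomial arguments.\<close>

locale henselian_char_0 = valued +
  assumes henselian: "henselian v"
    and v_of_nat: "n > 0 \<Longrightarrow> v (of_nat n) = 0"
begin

lemma of_nat_neq_0: "n > 0 \<Longrightarrow> of_nat n \<noteq> (0 :: 'a)"
  using v_of_nat[of n] by auto

lemma v_of_nat_mult: "n > 0 \<Longrightarrow> v (of_nat n * x) = v x"
  by (simp add: v_mult v_of_nat)

lemma v_coeff_zoom: "v (coeff (zoom f c d) i) = v (d ^ i * poly ((pderiv ^^ i) f) c)"
  by (metis fact_times_coeff_zoom v_of_nat_mult fact_gt_zero)

text \<open>The exact distance is the extra information: \<open>poly p a\<close> is
  \<open>b - a\<close> times a unit. It later turns smallness of a polynomial value into closeness
  of a root, which gives continuity.\<close>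

lemma hensel:
  assumes int: "\<And>i. 0 \<le> v (coeff p i)" and a: "0 \<le> v a"
    and "0 < v (poly p a)" and unit: "v (poly (pderiv p) a) = 0"
  shows "\<exists>b. poly p b = 0 \<and> 0 < v (b - a) \<and> v (b - a) = v (poly p a)"
proof -
  have "(\<forall>i. coeff p i \<in> valuation_ring v) \<and> a \<in> valuation_ring v \<and>
      poly p a \<in> maximal_ideal v \<and> poly (pderiv p) a \<in> valuation_units v"
    using assms by (simp add: valuation_ring_def maximal_ideal_def valuation_units_def)
  from henselian[unfolded henselian_def, rule_format, OF this]
  obtain b where b: "poly p b = 0" "0 < v (b - a)"
    by (auto simp: maximal_ideal_def)
  have "0 \<le> v (b - a)" using b(2) by simp
  from poly_linear_expansion[OF int a this]
  obtain r where r: "0 \<le> v r"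
    "poly p b = poly p a + (b - a) * (poly (pderiv p) a + (b - a) * r)" by auto
  define u where "u = poly (pderiv p) a + (b - a) * r"
  have "0 < v ((b - a) * r)" using b r by (intro v_mult_pos)
  then have "v (poly (pderiv p) a) < v (poly (pderiv p) a - u)"
    by (simp add: u_def unit)
  from v_eq_of_diff_gt[OF this] have "v u = 0" by (simp add: unit)
  moreover have "poly p a = - (u * (b - a))" using r b by (simp add: u_def algebra_simps add_eq_0_iff)
  ultimately have "v (poly p a) = v (b - a)" by (simp add: v_mult)
  with b show ?thesis by (intro exI[of _ b]) simp
qed

text \<open>The coefficients of \<open>zoom f c d\<close> are the terms of the Taylor expansion of \<open>f (c + d)\<close> at \<open>c\<close>.\<close>

definition no_cancel :: "'a poly \<Rightarrow> 'a \<Rightarrow> 'a \<Rightarrow> bool" where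
  "no_cancel f c d \<longleftrightarrow> (\<forall>i. v (poly f (c + d)) \<le> v (coeff (zoom f c d) i))"

text \<open>Imposed on derivatives rather than on Taylor coefficients, which would need division by
  factorials.\<close>

definition taylor_eq :: "'a poly \<Rightarrow> 'a \<Rightarrow> 'a poly \<Rightarrow> 'a \<Rightarrow> bool" where
  "taylor_eq f c f' c' \<longleftrightarrow> (\<forall>i. rv_eq (poly ((pderiv ^^ i) f) c) (poly ((pderiv ^^ i) f') c'))"

lemma rv_eq_coeff_zoom:
  assumes "taylor_eq f c f' c'" "rv_eq d d'"
  shows "rv_eq (coeff (zoom f c d) i) (coeff (zoom f' c' d') i)"
proof -
  have "rv_eq (of_nat (fact i) * coeff (zoom f c d) i) (of_nat (fact i) * coeff (zoom f' c' d') i)"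
    unfolding fact_times_coeff_zoom
    using assms by (intro rv_eq_mult rv_eq_power) (auto simp: taylor_eq_def)
  then show ?thesis by (rule rv_eq_mult_cancel_left) (simp add: of_nat_neq_0 del: of_nat_fact)
qed

text \<open>Each change of a coefficient has value above that of the coefficient, hence above
  \<open>v (poly p 1)\<close>, so the total change cannot reach the leading term of the sum.\<close>

lemma rv_eq_poly_one:
  assumes le: "\<And>i. v (poly p 1) \<le> v (coeff p i)" and eq: "\<And>i. rv_eq (coeff p i) (coeff q i)"
  shows "rv_eq (poly p 1) (poly q 1)"
proof (cases "poly p 1 = 0")
  \<comment> \<open>Without cancellation a zero sum forces every term to be zero; this case is
    separate because no value exceeds \<open>Infty\<close>.\<close>
  case True
  have "coeff p i = 0" for i using le[of i] True by simp
  then have "coeff q i = 0" for i using eq[of i] by simp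
  then have "q = 0" by (simp add: poly_eq_iff)
  with True show ?thesis by simp
next
  case False
  define n where "n = max (degree p) (degree q)"
  have "v (poly p 1) < v (\<Sum>i\<le>n. coeff p i - coeff q i)"
  proof (rule v_sum_gt)
    show "v (poly p 1) < Infty" using False by (metis v_eq_Infty_iff vinf_le_Infty order_le_less)
    show "v (poly p 1) < v (coeff p i - coeff q i)" for i
    proof (cases "coeff p i = coeff q i")
      case True
      then show ?thesis using False
        by (metis v_eq_Infty_iff vinf_le_Infty order_le_less right_minus_eq)
    next
      case False
      then show ?thesis using le[of i] eq[of i] by (auto simp: rv_eq_def)
    qed
  qed
  also have "(\<Sum>i\<le>n. coeff p i - coeff q i) = poly p 1 - poly q 1"
    using poly_eq_sum_coeff[of p n 1] poly_eq_sum_coeff[of q n 1]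
    by (simp add: n_def sum_subtractf)
  finally show ?thesis by (simp add: rv_eq_def)
qed

lemma no_cancel_rv_eq:
  assumes "no_cancel f c d" "taylor_eq f c f' c'" "rv_eq d d'"
  shows "rv_eq (poly f (c + d)) (poly f' (c' + d'))"
proof -
  have "rv_eq (poly (zoom f c d) 1) (poly (zoom f' c' d') 1)"
    using assms by (intro rv_eq_poly_one rv_eq_coeff_zoom) (auto simp: no_cancel_def)
  then show ?thesis by simp
qed

lemma ex_min_v_coeff: "\<exists>j. \<forall>i. v (coeff p j) \<le> v (coeff p i)"
proof -
  let ?A = "(\<lambda>i. v (coeff p i)) ` {..Suc (degree p)}"
  have "Min ?A \<in> ?A" by (intro Min_in) auto
  then obtain j where j: "Min ?A = v (coeff p j)" by (elim imageE)
  have "v (coeff p j) \<le> v (coeff p i)" for i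
  proof (cases "i \<le> degree p")
    case True
    then show ?thesis unfolding j[symmetric] by (intro Min_le) auto
  qed (simp add: coeff_eq_0)
  then show ?thesis by blast
qed

text \<open>In characteristic zero a nonzero residue polynomial cannot have all its derivatives
  vanish at 1.\<close>

lemma integral_unit_derivative:
  assumes int: "\<And>i. 0 \<le> v (coeff p i)" and j: "v (coeff p j) = 0"
  shows "\<exists>m. v (poly ((pderiv ^^ m) p) 1) = 0"
proof (rule ccontr)
  assume "\<not> ?thesis"
  moreover have "0 \<le> v (poly ((pderiv ^^ m) p) 1)" for m
    by (intro v_poly_nonneg v_coeff_higher_pderiv_nonneg int) simp
  ultimately have pos: "0 < v (poly ((pderiv ^^ m) p) 1)" for m
    by (metis order_le_less)
  \<comment> \<open>Expanding at 1 with increment -1 evaluates \<open>?q\<close> at 0, where it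
    equals \<open>fact j * coeff p j\<close>, a unit.\<close>
  let ?q = "(pderiv ^^ j) p"
  have "0 < v (coeff (zoom ?q 1 (-1)) i)" for i
  proof -
    have "0 < v (poly ((pderiv ^^ i) ?q) 1 * (-1) ^ i)"
      using pos[of "i + j"] by (intro v_mult_pos v_power_nonneg) (auto simp: funpow_add)
    then show ?thesis by (simp add: v_coeff_zoom mult.commute)
  qed
  then have "0 < v (poly (zoom ?q 1 (-1)) 1)"
    unfolding poly_altdef by (intro v_sum_gt) auto
  then have "0 < v (of_nat (fact j) * coeff p j)"
    by (simp add: fact_times_coeff del: of_nat_fact)
  then show False using j v_of_nat_mult[of "fact j" "coeff p j"] by simp
qed

text \<open>Where the residue polynomial of the rescaled \<open>f\<close> has a root of multiplicity \<open>m + 1\<close>,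
  its \<open>m\<close>-th derivative has a simple one, and Hensel's lemma lifts it to a better centre.\<close>

lemma recentre:
  assumes "\<not> no_cancel f c d"
  shows "\<exists>m b. (pderiv ^^ m) f \<noteq> 0 \<and> poly ((pderiv ^^ m) f) b = 0 \<and> v d < v (c + d - b)"
proof -
  define g where "g = zoom f c d"
  have g1: "poly g 1 = poly f (c + d)" by (simp add: g_def)
  obtain j where j: "v (coeff g j) \<le> v (coeff g i)" for i
    using ex_min_v_coeff[of g] by blast
  obtain i where "v (coeff g i) < v (poly g 1)"
    using assms by (auto simp: no_cancel_def g1 g_def not_le)
  with j[of i] have less: "v (coeff g j) < v (poly g 1)" by simp
  \<comment> \<open>Dividing by a coefficient of least value makes the polynomial integral with a
    coefficient 1, while the cancellation puts its value at 1 into the maximal ideal.\<close>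
  define s where "s = coeff g j"
  have s: "s \<noteq> 0" using less by (auto simp: s_def)
  define h where "h = smult (1 / s) g"
  have h_int: "0 \<le> v (coeff h i)" for i
    using v_divide_nonneg[OF s, of "coeff g i"] j by (simp add: h_def s_def)
  have "coeff h j = 1" using s by (simp add: h_def s_def)
  then obtain m0 where "v (poly ((pderiv ^^ m0) h) 1) = 0"
    using integral_unit_derivative[OF h_int, of j] by auto
  \<comment> \<open>The first derivative that is a unit at 1 is the derivative of one that is not,
    and the latter meets the hypotheses of \<open>hensel\<close> at 1.\<close>
  then obtain m where m: "v (poly ((pderiv ^^ m) h) 1) = 0"
    and least: "\<And>k. k < m \<Longrightarrow> v (poly ((pderiv ^^ k) h) 1) \<noteq> 0"
    using exists_least_iff[of "\<lambda>m. v (poly ((pderiv ^^ m) h) 1) = 0"] by blast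
  have h1: "0 < v (poly h 1)"
    using v_divide_pos[OF s, of "poly g 1"] less by (simp add: h_def s_def)
  then have "m \<noteq> 0" using m by (intro notI) simp
  then obtain k where k: "m = Suc k" by (cases m) auto
  let ?p = "(pderiv ^^ k) h"
  have p_int: "0 \<le> v (coeff ?p i)" for i by (intro v_coeff_higher_pderiv_nonneg h_int)
  have "0 \<le> v (poly ?p 1)" by (intro v_poly_nonneg p_int) simp
  then have "0 < v (poly ?p 1)" using least[of k] k by (metis lessI order_le_less)
  then obtain t where t: "poly ?p t = 0" "0 < v (t - 1)"
    using hensel[OF p_int _ \<open>0 < v (poly ?p 1)\<close>] m k by (simp, blast)
  have p_eq: "?p = smult (1 / s) (smult (d ^ k) (zoom ((pderiv ^^ k) f) c d))"
    by (simp add: h_def g_def higher_pderiv_smult higher_pderiv_zoom)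
  \<comment> \<open>At \<open>d = 0\<close> the expansion has only its constant term, so nothing can
    cancel.\<close>
  have d: "d \<noteq> 0"
  proof
    assume "d = 0"
    then have "no_cancel f c d"
      by (auto simp: no_cancel_def v_coeff_zoom power_0_left)
    with assms show False ..
  qed
  have "(pderiv ^^ k) f \<noteq> 0"
  proof
    assume "(pderiv ^^ k) f = 0"
    then have "?p = 0" by (simp add: p_eq zoom_def)
    then show False using m k by simp
  qed
  moreover have "poly ((pderiv ^^ k) f) (c + d * t) = 0"
    using t(1) s d by (simp add: p_eq)
  moreover have "v d < v (c + d - (c + d * t))"
  proof -
    have "v d + 0 < v d + v (t - 1)" using t(2) d by (intro vinf_add_strict_left_mono) auto
    also have "\<dots> = v (d * t - d)" by (simp add: right_diff_distrib flip: v_mult)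
    finally show ?thesis by (simp add: v_minus_commute)
  qed
  ultimately show ?thesis by blast
qed

text \<open>Among the finitely many candidates take one closest to \<open>y\<close>; a cancellation
  would let \<open>recentre\<close> produce a strictly closer one.\<close>

lemma ex_centre:
  assumes "finite S"
  shows "\<exists>c. (c = 0 \<or> (\<exists>f\<in>S. \<exists>m. (pderiv ^^ m) f \<noteq> 0 \<and> poly ((pderiv ^^ m) f) c = 0)) \<and>
             (\<forall>f\<in>S. no_cancel f c (y - c))"
proof -
  define C where
    "C = insert 0 (\<Union>f\<in>S. \<Union>m\<in>{m. (pderiv ^^ m) f \<noteq> 0}. {c. poly ((pderiv ^^ m) f) c = 0})"
  have "finite {m. (pderiv ^^ m) f \<noteq> 0}" for f :: "'a poly"
    by (rule finite_subset[of _ "{..degree f}"]) (auto simp: not_less[symmetric] higher_pderiv_eq_0)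
  then have fin: "finite C" using assms by (auto simp: C_def poly_roots_finite)
  let ?A = "(\<lambda>c. v (y - c)) ` C"
  have "Max ?A \<in> ?A" using fin by (intro Max_in) (auto simp: C_def)
  then obtain c where c: "Max ?A = v (y - c)" "c \<in> C" by (elim imageE)
  have "no_cancel f c (y - c)" if "f \<in> S" for f
  proof (rule ccontr)
    assume "\<not> no_cancel f c (y - c)"
    from recentre[OF this] obtain m b where
      "(pderiv ^^ m) f \<noteq> 0" "poly ((pderiv ^^ m) f) b = 0" "v (y - c) < v (y - b)"
      by auto
    moreover from this have "b \<in> C" using that by (auto simp: C_def)
    then have "v (y - b) \<le> Max ?A" using fin by auto
    ultimately show False using c by simp
  qed
  with c(2) show ?thesis by (auto simp: C_def)
qed

text \<open>The expansion of \<open>f\<close> sums to 0, so the derivative takes over: multiplied by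
  \<open>d\<close>, its value at the root bounds every term of the expansion from below. The bounds
  pass to \<open>f'\<close>, where Hensel's lemma gives a root. That \<epsilon> is chosen before
  \<open>f'\<close> and \<open>c'\<close> is what continuity requires.\<close>

lemma root_transfer:
  assumes root: "poly f (c + d) = 0" and f: "f \<noteq> 0" and nc: "no_cancel (pderiv f) c d"
  shows "\<exists>\<epsilon>. \<forall>f' c'. taylor_eq f c f' c' \<longrightarrow>
           (\<exists>y. poly f' y = 0 \<and> rv_eq d (y - c') \<and> v (poly f' (c' + d)) \<le> v (y - (c' + d)) + Fin \<epsilon>)"
proof (cases "d = 0")
  case True
  \<comment> \<open>With increment 0 the root is the centre itself, and it moves to
    \<open>c'\<close>; any \<epsilon> works.\<close>
  have "poly f' c' = 0" if "taylor_eq f c f' c'" for f' c'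
    using that[unfolded taylor_eq_def, rule_format, of 0] root True by simp
  then show ?thesis using True by (intro exI[of _ 0]) auto
next
  case d: False
  define g where "g = zoom f c d"
  define s where "s = poly (pderiv g) 1"
  have pderiv_g: "pderiv g = smult d (zoom (pderiv f) c d)"
    using higher_pderiv_zoom[of 1 f c d] by (simp add: g_def)
  have deriv_le: "v s \<le> v (coeff (pderiv g) i)" for i
    using nc[unfolded no_cancel_def, rule_format, of i]
    by (auto simp: s_def pderiv_g v_mult intro: add_left_mono)
  have le_Suc: "v s \<le> v (coeff g (Suc i))" for i
    using deriv_le[of i] v_of_nat_mult[of "Suc i" "coeff g (Suc i)"] unfolding coeff_pderiv by simp
  \<comment> \<open>\<open>le_Suc\<close> misses the constant coefficient; as the coefficients sum
    to 0, it is minus the sum of the others. The upper bound is a successor so that the first term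
    can be split off.\<close>
  have "(\<Sum>i\<le>Suc (degree g). coeff g i) = poly g 1"
    using poly_eq_sum_coeff[of g "Suc (degree g)" 1] by simp
  also have "\<dots> = 0" using root by (simp add: g_def)
  finally have "coeff g 0 = - (\<Sum>i\<le>degree g. coeff g (Suc i))"
    by (simp only: sum.atMost_Suc_shift add_eq_0_iff2) 
  then have "v s \<le> v (coeff g 0)" by (simp, intro v_sum_ge le_Suc)
  with le_Suc have le: "v s \<le> v (coeff g i)" for i by (cases i) auto
  \<comment> \<open>If \<open>s = 0\<close>, every coefficient would vanish; as
    \<open>d \<noteq> 0\<close>, undoing the rescaling would give \<open>f = 0\<close>.\<close>
  have s: "s \<noteq> 0"
  proof
    assume "s = 0"
    then have "coeff g i = 0" for i using le[of i] by simp
    then have "g = 0" by (simp add: poly_eq_iff)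
    then have "coeff g i = 0" for i by simp
    then have "poly ((pderiv ^^ i) f) c = 0" for i
      using d fact_times_coeff_zoom[of i f c d] by (simp add: g_def)
    then have "coeff (zoom f c 1) i = 0" for i
      using v_coeff_zoom[of f c 1 i] by simp
    then have "zoom f c 1 = 0" by (simp add: poly_eq_iff)
    then have "f = 0" unfolding zoom_def by (rule pcompose_eq_0) simp
    with f show False ..
  qed
  \<comment> \<open>\<epsilon> is the value of the derivative of \<open>f\<close> at
    \<open>c + d\<close>, because \<open>s\<close> is \<open>d\<close> times that derivative. The
    defaults 0 are never reached, as \<open>s\<close> and \<open>d\<close> are nonzero.\<close>
  define \<epsilon> where "\<epsilon> = (case v s of Fin a \<Rightarrow> (case v d of Fin b \<Rightarrow> a - b | Infty \<Rightarrow> 0) | Infty \<Rightarrow> 0)"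
  have \<epsilon>: "v s = v d + Fin \<epsilon>"
    using s d by (cases "v s"; cases "v d") (auto simp: \<epsilon>_def simp flip: v_eq_Infty_iff)
  have "\<exists>y. poly f' y = 0 \<and> rv_eq d (y - c') \<and> v (poly f' (c' + d)) \<le> v (y - (c' + d)) + Fin \<epsilon>"
    if te: "taylor_eq f c f' c'" for f' c'
  proof -
    define g' where "g' = zoom f' c' d"
    have eq: "rv_eq (coeff g i) (coeff g' i)" for i
      unfolding g_def g'_def using te by (rule rv_eq_coeff_zoom) simp
    define h where "h = smult (1 / s) g'"
    have h_int: "0 \<le> v (coeff h i)" for i
      using v_divide_nonneg[OF s, of "coeff g' i"] le[of i] rv_eq_v[OF eq, of i] by (simp add: h_def)
    have "rv_eq (coeff (pderiv g) i) (coeff (pderiv g') i)" for i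
      unfolding coeff_pderiv by (intro rv_eq_mult_left eq)
    then have "rv_eq s (poly (pderiv g') 1)"
      unfolding s_def by (intro rv_eq_poly_one deriv_le[unfolded s_def])
    then have unit: "v (poly (pderiv h) 1) = 0"
      using rv_eq_v v_divide_eq[OF s, of "poly (pderiv g') 1"] by (simp add: h_def pderiv_smult)
    define n where "n = max (degree g) (degree g')"
    \<comment> \<open>The coefficients of \<open>g'\<close> differ from those of \<open>g\<close> by
      elements of value above \<open>v s\<close>, and \<open>g\<close> vanishes at 1, so
      \<open>g'\<close> is small there.\<close>
    have "v s < v (\<Sum>i\<le>n. coeff g i - coeff g' i)"
    proof (rule v_sum_gt)
      show "v s < Infty" using s by (metis v_eq_Infty_iff vinf_le_Infty order_le_less)
      then show "v s < v (coeff g i - coeff g' i)" for i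
        using le[of i] eq[of i] by (cases "coeff g i = coeff g' i") (auto simp: rv_eq_def)
    qed
    also have "(\<Sum>i\<le>n. coeff g i - coeff g' i) = poly g 1 - poly g' 1"
      using poly_eq_sum_coeff[of g n 1] poly_eq_sum_coeff[of g' n 1]
      by (simp add: n_def sum_subtractf)
    also have "poly g 1 = 0" using root by (simp add: g_def)
    finally have "v s < v (poly g' 1)" by simp
    then have h1: "0 < v (poly h 1)"
      using v_divide_pos[OF s, of "poly g' 1"] by (simp add: h_def)
    then obtain t where t: "poly h t = 0" "0 < v (t - 1)" "v (t - 1) = v (poly h 1)"
      using hensel[OF h_int _ h1 unit] by (simp, blast)
    define y where "y = c' + d * t"
    have "poly f' y = 0" using t(1) s by (simp add: h_def g'_def y_def)
    moreover have diff: "v (y - (c' + d)) = v d + v (t - 1)"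
      by (simp add: y_def right_diff_distrib flip: v_mult)
    have "v d + 0 < v d + v (t - 1)" using t(2) d by (intro vinf_add_strict_left_mono) auto
    then have "v d < v (d - (y - c'))"
      using diff by (simp add: v_minus_commute[of y "c' + d"] algebra_simps)
    then have "rv_eq d (y - c')" by (simp add: rv_eq_def)
    moreover have "v (poly f' (c' + d)) = v s + v (poly h 1)"
      using v_divide_cancel[OF s, of "poly g' 1"] by (simp add: h_def g'_def)
    then have "v (poly f' (c' + d)) = v (y - (c' + d)) + Fin \<epsilon>"
      using diff t(3) by (simp add: \<epsilon> algebra_simps)
    ultimately show ?thesis by auto
  qed
  then show ?thesis by blast
qed

end

section \<open>Transfer of points along polynomial families\<close>

definition higher_derivs :: "nat \<Rightarrow> ('x \<Rightarrow> 'k::field poly) set \<Rightarrow> ('x \<Rightarrow> 'k poly) set" where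
  "higher_derivs n P = (\<lambda>(i, p) x. (pderiv ^^ i) (p x)) ` ({..n} \<times> P)"

lemma finite_higher_derivs: "finite P \<Longrightarrow> finite (higher_derivs n P)"
  by (simp add: higher_derivs_def)

section \<open>Convergence along filters\<close>

context valued
begin

definition vtends :: "'x filter \<Rightarrow> ('x \<Rightarrow> 'k) \<Rightarrow> 'k \<Rightarrow> bool" where
  "vtends F g l \<longleftrightarrow> (\<forall>\<gamma>. eventually (\<lambda>x. Fin \<gamma> < v (g x - l)) F)"

lemma vtends_const [simp]: "vtends F (\<lambda>_. c) c"
  by (simp add: vtends_def)

lemma vtends_add: "vtends F g l \<Longrightarrow> vtends F h m \<Longrightarrow> vtends F (\<lambda>x. g x + h x) (l + m)"
  unfolding vtends_def
proof
  fix \<gamma>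
  assume "\<forall>\<gamma>. eventually (\<lambda>x. Fin \<gamma> < v (g x - l)) F" "\<forall>\<gamma>. eventually (\<lambda>x. Fin \<gamma> < v (h x - m)) F"
  then have "eventually (\<lambda>x. Fin \<gamma> < v (g x - l)) F" "eventually (\<lambda>x. Fin \<gamma> < v (h x - m)) F"
    by auto
  then show "eventually (\<lambda>x. Fin \<gamma> < v (g x + h x - (l + m))) F"
  proof eventually_elim
    case (elim x)
    then have "Fin \<gamma> < v ((g x - l) + (h x - m))" by (rule v_add_gt)
    then show ?case by (simp add: algebra_simps)
  qed
qed

lemma vtends_minus: "vtends F g l \<Longrightarrow> vtends F (\<lambda>x. - g x) (- l)"
  unfolding vtends_def by (simp add: v_minus_commute)

lemma vtends_diff_iff: "vtends F (\<lambda>x. g x - l) 0 \<longleftrightarrow> vtends F g l"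
  by (simp add: vtends_def)

lemma vtends_mult_const:
  assumes "vtends F g 0"
  shows "vtends F (\<lambda>x. g x * c) 0"
proof (cases "v c")
  case (Fin \<mu>)
  show ?thesis
    unfolding vtends_def
  proof
    fix \<gamma>
    have "eventually (\<lambda>x. Fin (\<gamma> - \<mu>) < v (g x - 0)) F" using assms by (simp add: vtends_def)
    then show "eventually (\<lambda>x. Fin \<gamma> < v (g x * c - 0)) F"
    proof eventually_elim
      case (elim x)
      then show ?case using Fin by (cases "v (g x)") (auto simp: v_mult algebra_simps)
    qed
  qed
qed simp

lemma vtends_mult_0:
  assumes "vtends F g 0" "vtends F h 0"
  shows "vtends F (\<lambda>x. g x * h x) 0"
  unfolding vtends_def
proof
  fix \<gamma>
  have "eventually (\<lambda>x. Fin \<gamma> < v (g x - 0)) F" "eventually (\<lambda>x. Fin 0 < v (h x - 0)) F"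
    using assms unfolding vtends_def by blast+
  then show "eventually (\<lambda>x. Fin \<gamma> < v (g x * h x - 0)) F"
  proof eventually_elim
    case (elim x)
    then show ?case
      by (cases "v (g x)"; cases "v (h x)") (auto simp: v_mult add_strict_increasing2 less_imp_le add_pos_pos add_strict_mono[of \<gamma> _ 0, simplified])
  qed
qed

lemma vtends_mult:
  assumes "vtends F g l" "vtends F h m"
  shows "vtends F (\<lambda>x. g x * h x) (l * m)"
proof -
  have g: "vtends F (\<lambda>x. g x - l) 0" and h: "vtends F (\<lambda>x. h x - m) 0"
    using assms by (simp_all add: vtends_diff_iff)
  have "vtends F (\<lambda>x. (g x - l) * (h x - m) + ((g x - l) * m + (h x - m) * l)) (0 + (0 + 0))"
    by (intro vtends_add vtends_mult_0 vtends_mult_const g h)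
  then have "vtends F (\<lambda>x. g x * h x - l * m) 0" by (simp add: algebra_simps)
  then show ?thesis by (simp add: vtends_diff_iff)
qed

lemma vtends_power: "vtends F g l \<Longrightarrow> vtends F (\<lambda>x. g x ^ n) (l ^ n)"
  by (induction n) (auto intro: vtends_mult)

lemma vtends_sum: "(\<And>i. i \<in> I \<Longrightarrow> vtends F (g i) (l i)) \<Longrightarrow> vtends F (\<lambda>x. \<Sum>i\<in>I. g i x) (\<Sum>i\<in>I. l i)"
  by (induction I rule: infinite_finite_induct) (auto intro: vtends_add)

lemma vtends_poly:
  assumes "\<And>i. vtends F (\<lambda>x. coeff (p x) i) (coeff p0 i)" "\<And>x. degree (p x) \<le> n" "degree p0 \<le> n"
    and "vtends F y y0"
  shows "vtends F (\<lambda>x. poly (p x) (y x)) (poly p0 y0)"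
  using vtends_sum[of "{..n}" F "\<lambda>i x. coeff (p x) i * y x ^ i" "\<lambda>i. coeff p0 i * y0 ^ i"]
  by (simp add: poly_eq_sum_coeff[OF assms(2)] poly_eq_sum_coeff[OF assms(3)] assms vtends_mult vtends_power)

end

section \<open>Polynomials over a ring of functions\<close>

locale polynomial_family = henselian_char_0 v for v :: "'k::field \<Rightarrow> 'g::linordered_ab_group_add vinf" +
  fixes R :: "('x \<Rightarrow> 'k) set"
  assumes R_0: "(\<lambda>_. 0) \<in> R"
    and R_1: "(\<lambda>_. 1) \<in> R"
    and R_add: "f \<in> R \<Longrightarrow> g \<in> R \<Longrightarrow> (\<lambda>x. f x + g x) \<in> R"
    and R_minus: "f \<in> R \<Longrightarrow> (\<lambda>x. - f x) \<in> R"
    and R_mult: "f \<in> R \<Longrightarrow> g \<in> R \<Longrightarrow> (\<lambda>x. f x * g x) \<in> R"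
begin

lemma R_diff: "f \<in> R \<Longrightarrow> g \<in> R \<Longrightarrow> (\<lambda>x. f x - g x) \<in> R"
  using R_add[of f "\<lambda>x. - g x"] R_minus by simp

lemma R_of_nat: "(\<lambda>_. of_nat n) \<in> R"
  by (induction n) (auto intro: R_0 R_1 R_add)

lemma R_sum: "(\<And>i. i \<in> I \<Longrightarrow> f i \<in> R) \<Longrightarrow> (\<lambda>x. \<Sum>i\<in>I. f i x) \<in> R"
  by (induction I rule: infinite_finite_induct) (auto intro: R_0 R_add)

text \<open>\<open>n\<close> is a bound uniform in \<open>x\<close>; the true degree of
  \<open>p x\<close> may drop where coefficients vanish, which forces the case distinction in
  \<open>root_lifting_Suc\<close>.\<close>

definition polys :: "nat \<Rightarrow> ('x \<Rightarrow> 'k poly) set" where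
  "polys n = {p. (\<forall>i. (\<lambda>x. coeff (p x) i) \<in> R) \<and> (\<forall>x. degree (p x) \<le> n)}"

lemma polys_mono: "p \<in> polys m \<Longrightarrow> m \<le> n \<Longrightarrow> p \<in> polys n"
  unfolding polys_def using le_trans by blast

lemma finite_subset_polys:
  assumes "finite P" "P \<subseteq> (\<Union>n. polys n)"
  obtains n where "P \<subseteq> polys n"
proof -
  have "\<forall>p\<in>P. \<exists>n. p \<in> polys n" using assms(2) by blast
  then obtain n where n: "\<And>p. p \<in> P \<Longrightarrow> p \<in> polys (n p)" by metis
  have "P \<subseteq> polys (Max (n ` P))"
  proof
    fix p assume "p \<in> P"
    then show "p \<in> polys (Max (n ` P))"
      by (intro polys_mono[OF n] Max_ge) (use assms(1) in auto)
  qed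
  then show thesis by (rule that)
qed

lemma coeff_polys: "p \<in> polys n \<Longrightarrow> (\<lambda>x. coeff (p x) i) \<in> R"
  and degree_polys: "p \<in> polys n \<Longrightarrow> degree (p x) \<le> n"
  by (auto simp: polys_def)

lemma pderiv_polys:
  assumes "p \<in> polys n"
  shows "(\<lambda>x. pderiv (p x)) \<in> polys (n - 1)"
proof -
  have "degree (pderiv (p x)) \<le> n - 1" for x
    using degree_pderiv_le[of "p x"] degree_polys[OF assms, of x] by simp
  moreover have "(\<lambda>x. coeff (pderiv (p x)) i) \<in> R" for i
    unfolding coeff_pderiv by (intro R_mult R_of_nat coeff_polys[OF assms])
  ultimately show ?thesis by (simp add: polys_def)
qed

lemma higher_pderiv_polys:
  assumes "p \<in> polys n"
  shows "(\<lambda>x. (pderiv ^^ m) (p x)) \<in> polys n"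
proof (induction m)
  case (Suc m)
  then show ?case using polys_mono[OF pderiv_polys[OF Suc]] by simp
qed (simp add: assms)

lemma higher_derivs_polys: "P \<subseteq> polys n \<Longrightarrow> higher_derivs m P \<subseteq> polys n"
  by (auto simp: higher_derivs_def intro: higher_pderiv_polys)

lemma taylor_eq_higher_derivs:
  assumes "P \<subseteq> polys n" "p \<in> P"
    and eq: "\<And>r. r \<in> higher_derivs n P \<Longrightarrow> rv_eq (poly (r x) c) (poly (r x') c')"
  shows "taylor_eq (p x) c (p x') c'"
  unfolding taylor_eq_def
proof
  fix i
  show "rv_eq (poly ((pderiv ^^ i) (p x)) c) (poly ((pderiv ^^ i) (p x')) c')"
  proof (cases "i \<le> n")
    case True
    then have "(\<lambda>x. (pderiv ^^ i) (p x)) \<in> higher_derivs n P"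
      using assms(2) by (force simp: higher_derivs_def)
    from eq[OF this] show ?thesis .
  next
    case False
    have p: "p \<in> polys n" using assms by auto
    have "degree (p x) < i" "degree (p x') < i"
      using False degree_polys[OF p, of x] degree_polys[OF p, of x'] by auto
    then show ?thesis by (simp add: higher_pderiv_eq_0)
  qed
qed

definition rv_eq_on :: "('x \<Rightarrow> 'k) set \<Rightarrow> 'x \<Rightarrow> 'x \<Rightarrow> bool" where
  "rv_eq_on Q x x' \<longleftrightarrow> (\<forall>q\<in>Q. rv_eq (q x) (q x'))"

lemma rv_eq_on_mono: "rv_eq_on Q x x' \<Longrightarrow> Q' \<subseteq> Q \<Longrightarrow> rv_eq_on Q' x x'"
  by (auto simp: rv_eq_on_def)

definition R_tends :: "'x filter \<Rightarrow> 'x \<Rightarrow> bool" where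
  "R_tends F x \<longleftrightarrow> (\<forall>q\<in>R. vtends F q (q x))"

lemma vtends_polys:
  assumes "R_tends F x" "p \<in> polys n" "vtends F Y y"
  shows "vtends F (\<lambda>x'. poly (p x') (Y x')) (poly (p x) y)"
proof (rule vtends_poly[OF _ degree_polys[OF assms(2)] degree_polys[OF assms(2)] assms(3)])
  show "vtends F (\<lambda>x'. coeff (p x') i) (coeff (p x) i)" for i
    using assms(1) coeff_polys[OF assms(2), of i] by (auto simp: R_tends_def)
qed

text \<open>The clause on filters says that the transferred point \<open>Y x'\<close> depends continuously on \<open>x'\<close>
  at \<open>x\<close>, for any topology in which the functions in \<open>R\<close> are continuous.\<close>

definition lifts :: "('x \<Rightarrow> 'k) set \<Rightarrow> ('x \<Rightarrow> 'k poly) set \<Rightarrow> 'x \<Rightarrow> 'k \<Rightarrow> bool" where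
  "lifts Q P x y \<longleftrightarrow> (\<exists>Y.
     (\<forall>x'. rv_eq_on Q x x' \<longrightarrow> (\<forall>p\<in>P. rv_eq (poly (p x) y) (poly (p x') (Y x')))) \<and>
     (\<forall>F. R_tends F x \<longrightarrow> eventually (rv_eq_on Q x) F \<longrightarrow> vtends F Y y))"

lemma lifts_mono:
  assumes "lifts Q P x y" "Q \<subseteq> Q'"
  shows "lifts Q' P x y"
proof -
  have "eventually (rv_eq_on Q' x) F \<Longrightarrow> eventually (rv_eq_on Q x) F" for F
    by (erule eventually_mono) (use assms(2) rv_eq_on_mono in blast)
  then show ?thesis
    using assms rv_eq_on_mono unfolding lifts_def by meson
qed

text \<open>Only the degree of the equation \<open>f\<close> is bounded, that of the conditions
  \<open>P\<close> is not; so the induction on \<open>n\<close> may impose derivatives and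
  remainders as conditions. One \<open>Q\<close> must serve all \<open>x\<close> and
  \<open>y\<close>.\<close>

definition root_lifting :: "nat \<Rightarrow> bool" where
  "root_lifting n \<longleftrightarrow> (\<forall>f\<in>polys n. \<forall>P. finite P \<longrightarrow> P \<subseteq> (\<Union>m. polys m) \<longrightarrow>
     (\<exists>Q. finite Q \<and> Q \<subseteq> R \<and> (\<forall>x y. f x \<noteq> 0 \<longrightarrow> poly (f x) y = 0 \<longrightarrow> lifts Q P x y)))"

text \<open>The centre is 0 or a root of one of finitely many derivatives, all of degree at most
  \<open>n\<close>. Which one occurs depends on \<open>x\<close> and \<open>y\<close>, so their sets
  \<open>Q\<close> are united.\<close>

lemma centre_lifting:
  assumes n: "root_lifting n" and S: "finite S" "S \<subseteq> polys n"
    and P: "finite P" "P \<subseteq> (\<Union>m. polys m)"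
  shows "\<exists>Q. finite Q \<and> Q \<subseteq> R \<and>
           (\<forall>x y. \<exists>c. (\<forall>p\<in>S. no_cancel (p x) c (y - c)) \<and> lifts Q P x c)"
proof -
  define D where "D = higher_derivs n S"
  have D: "finite D" "D \<subseteq> polys n"
    using S by (simp_all add: D_def finite_higher_derivs higher_derivs_polys)
  have "\<forall>f\<in>D. \<exists>Q. finite Q \<and> Q \<subseteq> R \<and> (\<forall>x y. f x \<noteq> 0 \<longrightarrow> poly (f x) y = 0 \<longrightarrow> lifts Q P x y)"
    using n D(2) P unfolding root_lifting_def by blast
  from bchoice[OF this] obtain Qf where Qf: "\<forall>f\<in>D. finite (Qf f) \<and> Qf f \<subseteq> R \<and>
      (\<forall>x y. f x \<noteq> 0 \<longrightarrow> poly (f x) y = 0 \<longrightarrow> lifts (Qf f) P x y)" by blast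
  \<comment> \<open>At the centre 0, which moves to 0, the values of the conditions are their
    constant coefficients.\<close>
  define Q0 where "Q0 = (\<lambda>p x. coeff (p x) 0) ` P"
  define Q where "Q = Q0 \<union> (\<Union>f\<in>D. Qf f)"
  have "finite Q" using Qf D P by (auto simp: Q_def Q0_def)
  moreover have "Q \<subseteq> R"
  proof -
    have "(\<lambda>x. coeff (p x) 0) \<in> R" if "p \<in> P" for p
      using P(2) that by (auto intro: coeff_polys)
    then have "Q0 \<subseteq> R" unfolding Q0_def by (rule image_subsetI)
    moreover have "(\<Union>f\<in>D. Qf f) \<subseteq> R" using Qf by (intro UN_least) simp
    ultimately show ?thesis by (simp add: Q_def)
  qed
  moreover have "\<exists>c. (\<forall>p\<in>S. no_cancel (p x) c (y - c)) \<and> lifts Q P x c" for x y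
  proof -
    obtain c where c: "c = 0 \<or> (\<exists>p\<in>S. \<exists>m. (pderiv ^^ m) (p x) \<noteq> 0 \<and> poly ((pderiv ^^ m) (p x)) c = 0)"
        "\<forall>p\<in>S. no_cancel (p x) c (y - c)"
      using ex_centre[of "(\<lambda>p. p x) ` S" y] S by auto
    from c(1) have "lifts Q P x c"
    proof (elim disjE bexE exE conjE)
      assume "c = 0"
      then show ?thesis
        unfolding lifts_def
        by (intro exI[of _ "\<lambda>_. 0"]) (auto simp: rv_eq_on_def Q_def Q0_def poly_0_coeff_0)
    next
      fix p m
      assume p: "p \<in> S" and m: "(pderiv ^^ m) (p x) \<noteq> 0" "poly ((pderiv ^^ m) (p x)) c = 0"
      have "m \<le> degree (p x)" using m(1) higher_pderiv_eq_0 not_le by blast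
      also have "\<dots> \<le> n" using p S(2) degree_polys by blast
      finally have "(\<lambda>x. (pderiv ^^ m) (p x)) \<in> D"
        using p by (force simp: D_def higher_derivs_def)
      then have "lifts (Qf (\<lambda>x. (pderiv ^^ m) (p x))) P x c"
        and "Qf (\<lambda>x. (pderiv ^^ m) (p x)) \<subseteq> Q"
        using Qf m by (auto simp: Q_def)
      then show ?thesis by (rule lifts_mono)
    qed
    with c(2) show ?thesis by blast
  qed
  ultimately show ?thesis by blast
qed

text \<open>\<open>R\<close> is only a ring, so division by \<open>f\<close> is replaced by
  multiplying with its leading coefficient. The identity also holds where that coefficient vanishes,
  but its powers can be cancelled only elsewhere.\<close>

lemma pseudo_reduction:
  assumes f: "f \<in> polys (Suc d)" and p: "p \<in> polys n"
  shows "\<exists>k. \<exists>r\<in>polys d. \<forall>x y. poly (f x) y = 0 \<longrightarrow>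
           coeff (f x) (Suc d) ^ k * poly (p x) y = poly (r x) y"
  using p
proof (induction n arbitrary: p)
  case 0
  then show ?case using polys_mono[of p 0 d] by (intro exI[of _ 0] bexI[of _ p]) auto
next
  case (Suc n)
  show ?case
  proof (cases "Suc n \<le> d")
    case True
    then show ?thesis using polys_mono[OF Suc.prems True] by (intro exI[of _ 0] bexI[of _ p]) auto
  next
    case False
    \<comment> \<open>The factor \<open>monom\<close> raises \<open>f\<close> to formal degree
      \<open>Suc n\<close>, where the two leading coefficients cancel.\<close>
    define q where "q = (\<lambda>x. smult (coeff (f x) (Suc d)) (p x) -
      monom (coeff (p x) (Suc n)) (n - d) * f x)"
    have "(\<lambda>x. coeff (q x) i) \<in> R" for i
      by (cases "n - d \<le> i")
         (auto simp: q_def coeff_monom_mult intro!: R_diff R_mult R_0 coeff_polys[OF f] coeff_polys[OF Suc.prems])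
    moreover have "degree (q x) \<le> n" for x
    proof (rule degree_le, intro allI impI)
      fix i assume "n < i"
      show "coeff (q x) i = 0"
      proof (cases "i = Suc n")
        case True
        then show ?thesis using False by (simp add: q_def coeff_monom_mult Suc_diff_le)
      next
        case i: False
        then have "degree (p x) < i" "degree (f x) < i - (n - d)"
          using \<open>n < i\<close> False degree_polys[OF Suc.prems, of x] degree_polys[OF f, of x] by auto
        then show ?thesis using \<open>n < i\<close> by (simp add: q_def coeff_monom_mult coeff_eq_0)
      qed
    qed
    ultimately have "q \<in> polys n" by (simp add: polys_def)
    from Suc.IH[OF this] obtain k r where r: "r \<in> polys d"
      "\<And>x y. poly (f x) y = 0 \<Longrightarrow> coeff (f x) (Suc d) ^ k * poly (q x) y = poly (r x) y" by blast
    have "coeff (f x) (Suc d) ^ Suc k * poly (p x) y = poly (r x) y" if "poly (f x) y = 0" for x y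
      using r(2)[OF that] that by (simp add: q_def algebra_simps)
    with r(1) show ?thesis by blast
  qed
qed

text \<open>Vacuous, since a nonzero constant has no root.\<close>

lemma root_lifting_0: "root_lifting 0"
proof -
  have "f x = 0" if "f \<in> polys 0" "poly (f x) y = 0" for f x y
    using degree_polys[OF that(1), of x] that(2) by (auto elim: degree_eq_zeroE)
  then show ?thesis unfolding root_lifting_def by (metis empty_subsetI finite.emptyI)
qed

text \<open>Where the formal leading coefficient vanishes, dropping it lowers the degree. Elsewhere
  the conditions become remainders modulo \<open>f\<close>; the induction hypothesis supplies a
  movable centre for them and for the derivative of \<open>f\<close>, and
  \<open>root_transfer\<close> moves the root.\<close>

lemma root_lifting_Suc:
  assumes IH: "root_lifting d"
  shows "root_lifting (Suc d)"
  unfolding root_lifting_def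
proof (intro ballI allI impI)
  fix f P
  assume f: "f \<in> polys (Suc d)" and P: "finite P" "P \<subseteq> (\<Union>m. polys m)"
  define a where "a = (\<lambda>x. coeff (f x) (Suc d))"
  define f0 where "f0 = (\<lambda>x. f x - monom (a x) (Suc d))"
  have f0: "f0 \<in> polys d"
  proof -
    have "(\<lambda>x. coeff (f0 x) i) \<in> R" for i
      using coeff_polys[OF f, of i] R_0
      by (cases "i = Suc d") (auto simp: f0_def a_def)
    moreover have "degree (f0 x) \<le> d" for x
      by (rule degree_le) (use degree_polys[OF f, of x] in \<open>auto simp: f0_def a_def coeff_eq_0\<close>)
    ultimately show ?thesis by (simp add: polys_def)
  qed
  obtain Q1 where Q1: "finite Q1" "Q1 \<subseteq> R"
    "\<And>x y. f0 x \<noteq> 0 \<Longrightarrow> poly (f0 x) y = 0 \<Longrightarrow> lifts Q1 P x y"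
    using IH[unfolded root_lifting_def, rule_format, OF f0 P] by blast
  have "\<forall>p\<in>P. \<exists>kr. snd kr \<in> polys d \<and>
      (\<forall>x y. poly (f x) y = 0 \<longrightarrow> a x ^ fst kr * poly (p x) y = poly (snd kr x) y)"
  proof
    fix p assume "p \<in> P"
    then obtain m where "p \<in> polys m" using P(2) by blast
    from pseudo_reduction[OF f this] obtain k r where "r \<in> polys d"
      "\<forall>x y. poly (f x) y = 0 \<longrightarrow> a x ^ k * poly (p x) y = poly (r x) y"
      unfolding a_def by blast
    then show "\<exists>kr. snd kr \<in> polys d \<and>
      (\<forall>x y. poly (f x) y = 0 \<longrightarrow> a x ^ fst kr * poly (p x) y = poly (snd kr x) y)"
      by (intro exI[of _ "(k, r)"]) simp
  qed
  from bchoice[OF this] obtain kr where kr: "\<And>p. p \<in> P \<Longrightarrow> snd (kr p) \<in> polys d"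
    "\<And>p x y. p \<in> P \<Longrightarrow> poly (f x) y = 0 \<Longrightarrow> a x ^ fst (kr p) * poly (p x) y = poly (snd (kr p) x) y"
    by blast
  \<comment> \<open>Cancellation must be avoided for the derivative of \<open>f\<close> and the
    remainders, all of degree at most \<open>d\<close>. \<open>f\<close> itself belongs only to
    \<open>T\<close>, whose Taylor coefficients are to keep their leading terms.\<close>
  define S where "S = insert (\<lambda>x. pderiv (f x)) ((\<lambda>p. snd (kr p)) ` P)"
  define T where "T = insert f ((\<lambda>p. snd (kr p)) ` P)"
  have S: "finite S" "S \<subseteq> polys d" using P kr(1) pderiv_polys[OF f] by (auto simp: S_def)
  have T: "finite T" "T \<subseteq> polys (Suc d)"
    using P f polys_mono[OF kr(1), of _ "Suc d"] by (auto simp: T_def)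
  have hT: "finite (higher_derivs (Suc d) T)" "higher_derivs (Suc d) T \<subseteq> (\<Union>m. polys m)"
    using finite_higher_derivs[OF T(1)] higher_derivs_polys[OF T(2)] by blast+
  obtain Q2 where Q2: "finite Q2" "Q2 \<subseteq> R"
    "\<And>x y. \<exists>c. (\<forall>p\<in>S. no_cancel (p x) c (y - c)) \<and> lifts Q2 (higher_derivs (Suc d) T) x c"
    using centre_lifting[OF IH S hT] by blast
  \<comment> \<open>\<open>a\<close> is added so that its powers over \<open>x\<close> and over
    \<open>x'\<close> can be cancelled against each other.\<close>
  define Q where "Q = insert a (Q1 \<union> Q2)"
  have "finite Q" using Q1 Q2 by (simp add: Q_def)
  moreover have "Q \<subseteq> R" using Q1 Q2 coeff_polys[OF f] by (simp add: Q_def a_def)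
  moreover have "lifts Q P x y" if fx: "f x \<noteq> 0" and root: "poly (f x) y = 0" for x y
  proof (cases "a x = 0")
    case True
    then have "f0 x = f x" by (simp add: f0_def)
    then have "lifts Q1 P x y" using Q1(3) fx root by simp
    then show ?thesis by (rule lifts_mono) (auto simp: Q_def)
  next
    case False
    obtain c where nc: "\<And>p. p \<in> S \<Longrightarrow> no_cancel (p x) c (y - c)"
      and "lifts Q2 (higher_derivs (Suc d) T) x c"
      using Q2(3)[of x y] by blast
    then obtain C where C: "\<And>x' r. rv_eq_on Q2 x x' \<Longrightarrow> r \<in> higher_derivs (Suc d) T \<Longrightarrow>
        rv_eq (poly (r x) c) (poly (r x') (C x'))"
      and C_tends: "\<And>F. R_tends F x \<Longrightarrow> eventually (rv_eq_on Q2 x) F \<Longrightarrow> vtends F C c"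
      unfolding lifts_def by blast
    have Q2_of_Q: "rv_eq_on Q2 x x'" if "rv_eq_on Q x x'" for x'
      using that by (rule rv_eq_on_mono) (auto simp: Q_def)
    have te: "taylor_eq (p x) c (p x') (C x')" if "rv_eq_on Q x x'" "p \<in> T" for x' p
      using C[OF Q2_of_Q[OF that(1)]] by (intro taylor_eq_higher_derivs[OF T(2) that(2)]) blast
    have "poly (f x) (c + (y - c)) = 0" using root by simp
    moreover have "no_cancel (pderiv (f x)) c (y - c)"
      using nc[of "\<lambda>x. pderiv (f x)"] by (simp add: S_def)
    ultimately obtain \<epsilon> where \<epsilon>: "\<And>f' c'. taylor_eq (f x) c f' c' \<Longrightarrow>
      \<exists>z. poly f' z = 0 \<and> rv_eq (y - c) (z - c') \<and>
          v (poly f' (c' + (y - c))) \<le> v (z - (c' + (y - c))) + Fin \<epsilon>"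
      using root_transfer[OF _ fx] by blast
    have "\<forall>x'\<in>Collect (rv_eq_on Q x). \<exists>z. poly (f x') z = 0 \<and> rv_eq (y - c) (z - C x') \<and>
          v (poly (f x') (C x' + (y - c))) \<le> v (z - (C x' + (y - c))) + Fin \<epsilon>"
      using \<epsilon> te[of _ f] by (auto simp: T_def)
    from bchoice[OF this] obtain Y where Y: "\<And>x'. rv_eq_on Q x x' \<Longrightarrow> poly (f x') (Y x') = 0"
      "\<And>x'. rv_eq_on Q x x' \<Longrightarrow> rv_eq (y - c) (Y x' - C x')"
      "\<And>x'. rv_eq_on Q x x' \<Longrightarrow>
          v (poly (f x') (C x' + (y - c))) \<le> v (Y x' - (C x' + (y - c))) + Fin \<epsilon>"
      by auto
    have "rv_eq (poly (p x) y) (poly (p x') (Y x'))" if x': "rv_eq_on Q x x'" and p: "p \<in> P" for x' p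
    proof -
      let ?r = "snd (kr p)"
      have "rv_eq (poly (?r x) (c + (y - c))) (poly (?r x') (C x' + (Y x' - C x')))"
        using p by (intro no_cancel_rv_eq nc te x' Y(2)) (auto simp: S_def T_def)
      then have "rv_eq (a x ^ fst (kr p) * poly (p x) y) (a x' ^ fst (kr p) * poly (p x') (Y x'))"
        using kr(2)[OF p root] kr(2)[OF p Y(1)[OF x']] by simp
      moreover have "rv_eq (a x ^ fst (kr p)) (a x' ^ fst (kr p))"
        using x' by (intro rv_eq_power) (simp add: rv_eq_on_def Q_def)
      ultimately show ?thesis by (rule rv_eq_mult_cancel) (use False in simp)
    qed
    \<comment> \<open>The approximation \<open>C x' + (y - c)\<close> tends to the root
      \<open>y\<close> of \<open>f x\<close>, so the value of \<open>f x'\<close> at it tends to 0;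
      the fixed \<epsilon> turns this into closeness of \<open>Y x'\<close> to the
      approximation.\<close>
    moreover have "vtends F Y y" if F: "R_tends F x" "eventually (rv_eq_on Q x) F" for F
    proof -
      have "eventually (rv_eq_on Q2 x) F" using F(2) by (rule eventually_mono) (rule Q2_of_Q)
      then have C': "vtends F C c" using C_tends F(1) by blast
      then have "vtends F (\<lambda>x'. C x' + (y - c)) (c + (y - c))" by (intro vtends_add) auto
      from vtends_polys[OF F(1) f this]
      have f_tends: "vtends F (\<lambda>x'. poly (f x') (C x' + (y - c))) 0" using root by simp
      show ?thesis
        unfolding vtends_def
      proof
        fix \<gamma>
        have "eventually (\<lambda>x'. Fin \<gamma> < v (C x' - c)) F" using C' by (simp add: vtends_def)
        moreover have "eventually (\<lambda>x'. Fin (\<gamma> + \<epsilon>) < v (poly (f x') (C x' + (y - c)))) F"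
          using f_tends by (simp add: vtends_def)
        ultimately show "eventually (\<lambda>x'. Fin \<gamma> < v (Y x' - y)) F" using F(2)
        proof eventually_elim
          case (elim x')
          have "Fin (\<gamma> + \<epsilon>) < v (Y x' - (C x' + (y - c))) + Fin \<epsilon>"
            using elim(2) Y(3)[OF elim(3)] by (rule less_le_trans)
          then have "Fin \<gamma> < v (Y x' - (C x' + (y - c)))"
            by (cases "v (Y x' - (C x' + (y - c)))") auto
          from v_add_gt[OF this elim(1)] show ?case by simp
        qed
      qed
    qed
    ultimately show ?thesis unfolding lifts_def by blast
  qed
  ultimately show "\<exists>Q. finite Q \<and> Q \<subseteq> R \<and> (\<forall>x y. f x \<noteq> 0 \<longrightarrow> poly (f x) y = 0 \<longrightarrow> lifts Q P x y)"
    by blast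
qed

lemma root_lifting: "root_lifting n"
  by (induction n) (auto intro: root_lifting_0 root_lifting_Suc)

text \<open>With no equation imposed on \<open>y\<close>, the increment \<open>y - c\<close> can be
  kept and only the centre moves; absence of cancellation for all of \<open>P\<close> does the
  rest.\<close>

theorem lifting:
  assumes "finite P" "P \<subseteq> (\<Union>m. polys m)"
  obtains Q where "finite Q" "Q \<subseteq> R" "\<And>x y. lifts Q P x y"
proof -
  obtain n where P: "P \<subseteq> polys n" using finite_subset_polys[OF assms] .
  have hP: "finite (higher_derivs n P)" "higher_derivs n P \<subseteq> (\<Union>m. polys m)"
    using finite_higher_derivs[OF assms(1)] higher_derivs_polys[OF P] by blast+
  obtain Q where Q: "finite Q" "Q \<subseteq> R"
    "\<And>x y. \<exists>c. (\<forall>p\<in>P. no_cancel (p x) c (y - c)) \<and> lifts Q (higher_derivs n P) x c"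
    using centre_lifting[OF root_lifting assms(1) P hP] by blast
  have "lifts Q P x y" for x y
  proof -
    obtain c where nc: "\<And>p. p \<in> P \<Longrightarrow> no_cancel (p x) c (y - c)"
      and "lifts Q (higher_derivs n P) x c"
      using Q(3)[of x y] by blast
    then obtain C where C: "\<And>x' r. rv_eq_on Q x x' \<Longrightarrow> r \<in> higher_derivs n P \<Longrightarrow>
        rv_eq (poly (r x) c) (poly (r x') (C x'))"
      and C_tends: "\<And>F. R_tends F x \<Longrightarrow> eventually (rv_eq_on Q x) F \<Longrightarrow> vtends F C c"
      unfolding lifts_def by blast
    let ?Y = "\<lambda>x'. C x' + (y - c)"
    have "rv_eq (poly (p x) y) (poly (p x') (?Y x'))" if "rv_eq_on Q x x'" "p \<in> P" for x' p
    proof -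
      have "taylor_eq (p x) c (p x') (C x')"
        using C[OF that(1)] by (intro taylor_eq_higher_derivs[OF P that(2)]) blast
      from no_cancel_rv_eq[OF nc[OF that(2)] this rv_eq_refl] show ?thesis by simp
    qed
    moreover have "vtends F ?Y y" if "R_tends F x" "eventually (rv_eq_on Q x) F" for F
      using vtends_add[OF C_tends[OF that] vtends_const[of F "y - c"]] by simp
    ultimately show ?thesis unfolding lifts_def by (intro exI[of _ ?Y]) blast
  qed
  with Q show thesis by (intro that)
qed

end

section \<open>Elimination of field quantifiers\<close>

text \<open>Residue characteristic zero enters here: \<open>res\<close> maps a positive integer to a
  nonzero element, so it lies outside the maximal ideal.\<close>

lemma (in valued) v_of_nat_of_residue:
  fixes res :: "'k \<Rightarrow> 'r::field_char_0"
  assumes res: "residue_map v res" and n: "n > 0"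
  shows "v (of_nat n) = 0"
proof -
  have ring: "of_nat m \<in> valuation_ring v" "1 \<in> valuation_ring v" for m
    using v_of_nat_nonneg by (simp_all add: valuation_ring_def)
  have add: "res (x + y) = res x + res y" if "x \<in> valuation_ring v" "y \<in> valuation_ring v" for x y
    using res that by (simp add: residue_map_def)
  have res_of_nat: "res (of_nat m) = of_nat m" for m
  proof (induction m)
    case 0
    show ?case using add[of 0 0] ring(1)[of 0] by simp
  next
    case (Suc m)
    then show ?case using add ring res by (simp add: residue_map_def)
  qed
  have "of_nat n \<notin> maximal_ideal v"
  proof
    assume "of_nat n \<in> maximal_ideal v"
    then have "res (of_nat n) = 0" using res unfolding residue_map_def by blast
    then show False using n by (simp add: res_of_nat)
  qed
  then show ?thesis using v_of_nat_nonneg[of n] by (simp add: maximal_ideal_def)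
qed

section \<open>Field terms as polynomials in one variable\<close>

primrec kterm_poly :: "nat \<Rightarrow> (nat \<Rightarrow> 'k::field) \<Rightarrow> kterm \<Rightarrow> 'k poly" where
  "kterm_poly i x (KVar j) = (if j = i then [:0, 1:] else [:x j:])"
| "kterm_poly i x KZero = 0"
| "kterm_poly i x KOne = 1"
| "kterm_poly i x (KAdd s t) = kterm_poly i x s + kterm_poly i x t"
| "kterm_poly i x (KUminus t) = - kterm_poly i x t"
| "kterm_poly i x (KMult s t) = kterm_poly i x s * kterm_poly i x t"

lemma poly_kterm_poly: "poly (kterm_poly i x t) y = eval_k (x(i := y)) t"
  by (induction t) auto

definition kterm_funs :: "((nat \<Rightarrow> 'k::field) \<Rightarrow> 'k) set" where
  "kterm_funs = range (\<lambda>t x. eval_k x t)"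

primrec gterm_kterms :: "'gf gterm \<Rightarrow> kterm set" where
  "gterm_kterms (GVar i) = {}"
| "gterm_kterms GZero = {}"
| "gterm_kterms GInfty = {}"
| "gterm_kterms (GAdd s t) = gterm_kterms s \<union> gterm_kterms t"
| "gterm_kterms (GUminus t) = gterm_kterms t"
| "gterm_kterms (GVal t) = {t}"
| "gterm_kterms (GFun F ts) = \<Union> (set (map gterm_kterms ts))"

primrec rterm_kterms :: "'rf rterm \<Rightarrow> kterm set" where
  "rterm_kterms (RVar i) = {}"
| "rterm_kterms RZero = {}"
| "rterm_kterms ROne = {}"
| "rterm_kterms (RAdd s t) = rterm_kterms s \<union> rterm_kterms t"
| "rterm_kterms (RUminus t) = rterm_kterms t"
| "rterm_kterms (RMult s t) = rterm_kterms s \<union> rterm_kterms t"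
| "rterm_kterms (RAc t) = {t}"
| "rterm_kterms (RFun F ts) = \<Union> (set (map rterm_kterms ts))"

lemma finite_gterm_kterms: "finite (gterm_kterms t)"
  by (induction t) auto

lemma finite_rterm_kterms: "finite (rterm_kterms t)"
  by (induction t) auto

locale henselian_pas =
  fixes M :: "('k::field, 'g::linordered_ab_group_add, 'r::field_char_0, 'gf, 'gp, 'rf, 'rp) pas_structure"
    and res :: "'k \<Rightarrow> 'r"
  assumes valuation_M: "valuation (val M)"
    and henselian_M: "henselian (val M)"
    and residue_M: "residue_map (val M) res"
    and angular_M: "angular_component (val M) res (ac M)"
begin

sublocale polynomial_family "val M" "kterm_funs"
proof -
  interpret valued "val M" by unfold_locales (rule valuation_M)
  have eq: "f \<in> kterm_funs" if "f = (\<lambda>x. eval_k x t)" for f t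
    using that by (auto simp: kterm_funs_def)
  show "polynomial_family (val M) (kterm_funs)"
  proof
    show "henselian (val M)" by (rule henselian_M)
    show "val M (of_nat n) = 0" if "n > 0" for n
      using v_of_nat_of_residue[OF residue_M that] .
    show "(\<lambda>_. 0) \<in> kterm_funs" by (rule eq[of _ KZero]) simp
    show "(\<lambda>_. 1) \<in> kterm_funs" by (rule eq[of _ KOne]) simp
    fix f g :: "(nat \<Rightarrow> 'k) \<Rightarrow> 'k"
    assume "f \<in> kterm_funs"
    then obtain s where s: "f = (\<lambda>x. eval_k x s)" by (auto simp: kterm_funs_def)
    show "(\<lambda>x. - f x) \<in> kterm_funs" by (rule eq[of _ "KUminus s"]) (simp add: s)
    assume "g \<in> kterm_funs"
    then obtain t where t: "g = (\<lambda>x. eval_k x t)" by (auto simp: kterm_funs_def)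
    show "(\<lambda>x. f x + g x) \<in> kterm_funs"
      by (rule eq[of _ "KAdd s t"]) (simp add: s t)
    show "(\<lambda>x. f x * g x) \<in> kterm_funs"
      by (rule eq[of _ "KMult s t"]) (simp add: s t)
  qed
qed

abbreviation v :: "'k \<Rightarrow> 'g vinf" where "v \<equiv> val M"

lemma R_var: "(\<lambda>x :: nat \<Rightarrow> 'k. x j) \<in> kterm_funs"
  using rangeI[of "\<lambda>t x. eval_k x t" "KVar j"] by (simp add: kterm_funs_def)

lemma kterm_poly_polys: "\<exists>n. (\<lambda>x :: nat \<Rightarrow> 'k. kterm_poly i x t) \<in> polys n"
proof (induction t)
  case (KVar j)
  have "(\<lambda>x :: nat \<Rightarrow> 'k. coeff [:x j:] m) \<in> kterm_funs" for m
    using R_var[of j] R_0 by (cases m) simp_all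
  moreover have "(\<lambda>x :: nat \<Rightarrow> 'k. coeff [:0, 1:] m) \<in> kterm_funs" for m
    using R_0 R_1 by (cases m; cases "m - 1") (simp_all add: coeff_pCons split: nat.split)
  ultimately have "(\<lambda>x :: nat \<Rightarrow> 'k. kterm_poly i x (KVar j)) \<in> polys 1"
    by (cases "j = i") (simp_all add: polys_def)
  then show ?case ..
next
  case KZero
  show ?case using R_0 by (intro exI[of _ 0]) (simp add: polys_def)
next
  case KOne
  have "(\<lambda>x :: nat \<Rightarrow> 'k. coeff 1 m) \<in> kterm_funs" for m
    using R_0 R_1 by (cases m) simp_all
  then show ?case by (intro exI[of _ 0]) (simp add: polys_def)
next
  case (KAdd s t)
  then obtain m n where s: "(\<lambda>x :: nat \<Rightarrow> 'k. kterm_poly i x s) \<in> polys m" and t: "(\<lambda>x :: nat \<Rightarrow> 'k. kterm_poly i x t) \<in> polys n"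
    by blast
  have "degree (kterm_poly i x s + kterm_poly i x t) \<le> max m n" for x :: "nat \<Rightarrow> 'k"
    using degree_polys[OF s, of x] degree_polys[OF t, of x] by (intro degree_add_le) auto
  then have "(\<lambda>x :: nat \<Rightarrow> 'k. kterm_poly i x (KAdd s t)) \<in> polys (max m n)"
    using R_add[OF coeff_polys[OF s] coeff_polys[OF t]] by (simp add: polys_def)
  then show ?case ..
next
  case (KUminus t)
  then obtain n where t: "(\<lambda>x :: nat \<Rightarrow> 'k. kterm_poly i x t) \<in> polys n" by blast
  have "(\<lambda>x :: nat \<Rightarrow> 'k. kterm_poly i x (KUminus t)) \<in> polys n"
    using R_minus[OF coeff_polys[OF t]] degree_polys[OF t] by (simp add: polys_def)
  then show ?case ..
next
  case (KMult s t)
  then obtain m n where s: "(\<lambda>x :: nat \<Rightarrow> 'k. kterm_poly i x s) \<in> polys m" and t: "(\<lambda>x :: nat \<Rightarrow> 'k. kterm_poly i x t) \<in> polys n"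
    by blast
  have "degree (kterm_poly i x s * kterm_poly i x t) \<le> m + n" for x :: "nat \<Rightarrow> 'k"
    using degree_polys[OF s, of x] degree_polys[OF t, of x]
      degree_mult_le[of "kterm_poly i x s" "kterm_poly i x t"] by simp
  moreover have "(\<lambda>x :: nat \<Rightarrow> 'k. coeff (kterm_poly i x s * kterm_poly i x t) j) \<in> kterm_funs" for j
    unfolding coeff_mult by (intro R_sum R_mult coeff_polys[OF s] coeff_polys[OF t])
  ultimately have "(\<lambda>x :: nat \<Rightarrow> 'k. kterm_poly i x (KMult s t)) \<in> polys (m + n)" by (simp add: polys_def)
  then show ?case ..
qed

definition same_rv :: "kterm set \<Rightarrow> (nat \<Rightarrow> 'k) \<Rightarrow> (nat \<Rightarrow> 'k) \<Rightarrow> bool" where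
  "same_rv T x x' \<longleftrightarrow> (\<forall>t\<in>T. rv_eq (eval_k x t) (eval_k x' t))"

lemma same_rv_sym: "same_rv T x x' \<Longrightarrow> same_rv T x' x"
  by (auto simp: same_rv_def rv_eq_sym)

lemma same_rv_mono: "same_rv T x x' \<Longrightarrow> T' \<subseteq> T \<Longrightarrow> same_rv T' x x'"
  by (auto simp: same_rv_def)

text \<open>Variable \<open>i\<close> becomes the indeterminate. The first clause removes a
  quantifier \<open>KEx i\<close>, and the second makes its witness continuous.\<close>

lemma kterm_lifting:
  assumes "finite T"
  obtains T' where "finite T'"
    "\<And>x y. \<exists>Y. (\<forall>x'. same_rv T' x x' \<longrightarrow> same_rv T (x(i := y)) (x'(i := Y x'))) \<and>
       (\<forall>F. R_tends F x \<longrightarrow> eventually (same_rv T' x) F \<longrightarrow> vtends F Y y)"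
proof -
  define P where "P = (\<lambda>t (x :: nat \<Rightarrow> 'k). kterm_poly i x t) ` T"
  have "finite P" "P \<subseteq> (\<Union>m. polys m)"
    using assms kterm_poly_polys by (auto simp: P_def)
  from lifting[OF this] obtain Q where Q: "finite Q" "Q \<subseteq> kterm_funs"
    "\<And>x y. lifts Q P x y" by blast
  from finite_subset_image[OF Q(1) Q(2)[unfolded kterm_funs_def]] obtain T' where T': "finite T'" "Q = (\<lambda>t x. eval_k x t) ` T'"
    by blast
  have "rv_eq_on Q x = same_rv T' x" for x
    by (auto simp: rv_eq_on_def same_rv_def T'(2))
  with Q(3) have "\<exists>Y. (\<forall>x'. same_rv T' x x' \<longrightarrow> same_rv T (x(i := y)) (x'(i := Y x'))) \<and>
       (\<forall>F. R_tends F x \<longrightarrow> eventually (same_rv T' x) F \<longrightarrow> vtends F Y y)" for x y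
    by (simp add: lifts_def P_def same_rv_def poly_kterm_poly)
  with T'(1) show thesis by (rule that)
qed

lemma eval_g_same_rv:
  "same_rv (gterm_kterms t) x x' \<Longrightarrow> eval_g M x g t = eval_g M x' g t"
proof (induction t)
  case (GFun F ts)
  have "eval_g M x g t = eval_g M x' g t" if "t \<in> set ts" for t
    using that by (intro GFun.IH same_rv_mono[OF GFun.prems]) auto
  then show ?case by (simp cong: map_cong)
next
  case (GVal t)
  then show ?case by (auto simp: same_rv_def dest: rv_eq_v)
qed (auto simp: same_rv_def)

lemma eval_r_same_rv:
  "same_rv (rterm_kterms t) x x' \<Longrightarrow> eval_r M x r t = eval_r M x' r t"
proof (induction t)
  case (RFun F ts)
  have "eval_r M x r t = eval_r M x' r t" if "t \<in> set ts" for t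
    using that by (intro RFun.IH same_rv_mono[OF RFun.prems]) auto
  then show ?case by (simp cong: map_cong)
next
  case (RAc t)
  then show ?case using rv_eq_ac[OF residue_M angular_M] by (simp add: same_rv_def)
qed (auto simp: same_rv_def)

text \<open>\<open>T\<close> is chosen before the values of the other sorts, so their quantifiers
  leave it unchanged. For a field quantifier the witness is moved, and symmetry of
  \<open>same_rv\<close> gives the converse.\<close>

theorem sat_same_rv:
  "\<exists>T. finite T \<and> (\<forall>x x' g r. same_rv T x x' \<longrightarrow> sat M x g r \<phi> = sat M x' g r \<phi>)"
proof (induction \<phi>)
  case (KEq s t)
  \<comment> \<open>The leading terms of \<open>s\<close> and \<open>t\<close> separately would not
    decide equality; that of their difference does, since it detects 0.\<close>
  have "eval_k x s = eval_k x t \<longleftrightarrow> eval_k x' s = eval_k x' t"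
    if "same_rv {KAdd s (KUminus t)} x x'" for x x'
    using that rv_eq_0_iff by (fastforce simp: same_rv_def)
  then show ?case by (intro exI[of _ "{KAdd s (KUminus t)}"]) auto
next
  case (GEq s t)
  show ?case
  proof (intro exI[of _ "gterm_kterms s \<union> gterm_kterms t"] conjI allI impI)
    fix x x' :: "nat \<Rightarrow> 'k" and g r
    assume *: "same_rv (gterm_kterms s \<union> gterm_kterms t) x x'"
    have "same_rv (gterm_kterms s) x x'" "same_rv (gterm_kterms t) x x'"
      by (rule same_rv_mono[OF *], simp)+
    then show "sat M x g r (GEq s t) = sat M x' g r (GEq s t)"
      using eval_g_same_rv[of _ x x' g] by simp
  qed (simp add: finite_gterm_kterms)
next
  case (GLess s t)
  show ?case
  proof (intro exI[of _ "gterm_kterms s \<union> gterm_kterms t"] conjI allI impI)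
    fix x x' :: "nat \<Rightarrow> 'k" and g r
    assume *: "same_rv (gterm_kterms s \<union> gterm_kterms t) x x'"
    have "same_rv (gterm_kterms s) x x'" "same_rv (gterm_kterms t) x x'"
      by (rule same_rv_mono[OF *], simp)+
    then show "sat M x g r (GLess s t) = sat M x' g r (GLess s t)"
      using eval_g_same_rv[of _ x x' g] by simp
  qed (simp add: finite_gterm_kterms)
next
  case (GRel P ts)
  show ?case
  proof (intro exI[of _ "\<Union> (gterm_kterms ` set ts)"] conjI allI impI)
    fix x x' :: "nat \<Rightarrow> 'k" and g r
    assume "same_rv (\<Union> (gterm_kterms ` set ts)) x x'"
    then have "eval_g M x g t = eval_g M x' g t" if "t \<in> set ts" for t
      by (rule eval_g_same_rv[OF same_rv_mono]) (use that in auto)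
    then show "sat M x g r (GRel P ts) = sat M x' g r (GRel P ts)" by (simp cong: map_cong)
  qed (simp add: finite_gterm_kterms)
next
  case (REq s t)
  show ?case
  proof (intro exI[of _ "rterm_kterms s \<union> rterm_kterms t"] conjI allI impI)
    fix x x' :: "nat \<Rightarrow> 'k" and g r
    assume *: "same_rv (rterm_kterms s \<union> rterm_kterms t) x x'"
    have "same_rv (rterm_kterms s) x x'" "same_rv (rterm_kterms t) x x'"
      by (rule same_rv_mono[OF *], simp)+
    then show "sat M x g r (REq s t) = sat M x' g r (REq s t)"
      using eval_r_same_rv[of _ x x' r] by simp
  qed (simp add: finite_rterm_kterms)
next
  case (RRel P ts)
  show ?case
  proof (intro exI[of _ "\<Union> (rterm_kterms ` set ts)"] conjI allI impI)
    fix x x' :: "nat \<Rightarrow> 'k" and g r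
    assume "same_rv (\<Union> (rterm_kterms ` set ts)) x x'"
    then have "eval_r M x r t = eval_r M x' r t" if "t \<in> set ts" for t
      by (rule eval_r_same_rv[OF same_rv_mono]) (use that in auto)
    then show "sat M x g r (RRel P ts) = sat M x' g r (RRel P ts)" by (simp cong: map_cong)
  qed (simp add: finite_rterm_kterms)
next
  case (Neg \<phi>)
  then show ?case by (simp add: imp_conjL)
next
  case (Conj \<phi> \<psi>)
  then obtain T U where T: "finite T" "\<forall>x x' g r. same_rv T x x' \<longrightarrow> sat M x g r \<phi> = sat M x' g r \<phi>"
    and U: "finite U" "\<forall>x x' g r. same_rv U x x' \<longrightarrow> sat M x g r \<psi> = sat M x' g r \<psi>" by blast
  show ?case
  proof (intro exI[of _ "T \<union> U"] conjI allI impI)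
    fix x x' :: "nat \<Rightarrow> 'k" and g r
    assume *: "same_rv (T \<union> U) x x'"
    have "same_rv T x x'" "same_rv U x x'"
      by (rule same_rv_mono[OF *], simp)+
    then show "sat M x g r (Conj \<phi> \<psi>) = sat M x' g r (Conj \<phi> \<psi>)" using T U by simp
  qed (use T U in simp)
next
  case (KEx i \<phi>)
  then obtain T where T: "finite T" "\<And>x x' g r. same_rv T x x' \<Longrightarrow> sat M x g r \<phi> = sat M x' g r \<phi>"
    by blast
  obtain T' where T': "finite T'"
    "\<And>x y. \<exists>Y. (\<forall>x'. same_rv T' x x' \<longrightarrow> same_rv T (x(i := y)) (x'(i := Y x'))) \<and>
       (\<forall>F. R_tends F x \<longrightarrow> eventually (same_rv T' x) F \<longrightarrow> vtends F Y y)"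
    using kterm_lifting[OF T(1), of i] by blast
  have imp: "sat M x' g r (KEx i \<phi>)" if eq: "same_rv T' x x'" and sat: "sat M x g r (KEx i \<phi>)"
    for x x' g r
  proof -
    from sat obtain y where y: "sat M (x(i := y)) g r \<phi>" by auto
    obtain y' where "same_rv T (x(i := y)) (x'(i := y'))"
      using T'(2)[of x y] eq by blast
    from T(2)[OF this] y show ?thesis by auto
  qed
  show ?case
    using T'(1) imp same_rv_sym by (intro exI[of _ T'] conjI allI impI iffI) blast+
next
  case (GEx i \<phi>)
  then show ?case by (metis sat.simps(10))
next
  case (REx i \<phi>)
  then show ?case by (metis sat.simps(11))
qed

end

section \<open>Local constancy and continuity\<close>

abbreviation with_params :: "nat \<Rightarrow> (nat \<Rightarrow> 'k) \<Rightarrow> (nat \<Rightarrow> 'k) \<Rightarrow> nat \<Rightarrow> 'k" where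
  "with_params n a x \<equiv> (\<lambda>i. if i < n then x i else a i)"

section \<open>Neighbourhoods in powers of K\<close>

context valued
begin

lemma vtends_filtermap: "vtends (filtermap h F) g l \<longleftrightarrow> vtends F (\<lambda>x. g (h x)) l"
  by (simp add: vtends_def eventually_filtermap)

definition box :: "nat \<Rightarrow> (nat \<Rightarrow> 'k) \<Rightarrow> 'g \<Rightarrow> (nat \<Rightarrow> 'k) set" where
  "box n x \<gamma> = {x' \<in> Kpow n. \<forall>i<n. Fin \<gamma> < v (x' i - x i)}"

lemma openin_box: "openin (Kpow_topology v n) (box n x \<gamma>)"
proof -
  have "openin (K_topology v) {y. Fin \<gamma> < v (y - c)}" for c
    unfolding openin_K_topology
  proof
    fix x assume x: "x \<in> {y. Fin \<gamma> < v (y - c)}"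
    have "Fin \<gamma> < v (y - c)" if "Fin \<gamma> < v (y - x)" for y
      using v_add_gt[of "Fin \<gamma>" "y - x" "x - c"] that x by simp
    then show "\<exists>\<delta>. {y. Fin \<delta> < v (y - x)} \<subseteq> {y. Fin \<gamma> < v (y - c)}" by blast
  qed
  moreover have "box n x \<gamma> = (\<Pi>\<^sub>E i\<in>{..<n}. {y. Fin \<gamma> < v (y - x i)})"
    by (auto simp: box_def Kpow_def PiE_def Pi_def)
  ultimately show ?thesis
    unfolding Kpow_topology_def by (simp add: openin_PiE)
qed

definition near :: "nat \<Rightarrow> (nat \<Rightarrow> 'k) \<Rightarrow> (nat \<Rightarrow> 'k) filter" where
  "near n x = (INF \<gamma>. principal (box n x \<gamma>))"

lemma eventually_near: "eventually P (near n x) \<longleftrightarrow> (\<exists>\<gamma>. \<forall>x'\<in>box n x \<gamma>. P x')"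
proof -
  have "\<exists>\<gamma>\<in>UNIV. principal (box n x \<gamma>) \<le> inf (principal (box n x \<alpha>)) (principal (box n x \<beta>))" for \<alpha> \<beta>
  proof (intro bexI[of _ "max \<alpha> \<beta>"])
    have "Fin \<alpha> \<le> Fin (max \<alpha> \<beta>)" "Fin \<beta> \<le> Fin (max \<alpha> \<beta>)" by auto
    then have "box n x (max \<alpha> \<beta>) \<subseteq> box n x \<alpha> \<inter> box n x \<beta>"
      unfolding box_def by (blast intro: le_less_trans)
    then show "principal (box n x (max \<alpha> \<beta>)) \<le> inf (principal (box n x \<alpha>)) (principal (box n x \<beta>))"
      by (simp add: principal_le_iff)
  qed simp
  then show ?thesis
    unfolding near_def by (subst eventually_INF_base) (auto simp: eventually_principal)
qed

lemma eventually_near_open: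
  assumes "x \<in> Kpow n" "eventually P (near n x)"
  obtains W where "openin (Kpow_topology v n) W" "x \<in> W" "\<forall>x'\<in>W. P x'"
proof -
  obtain \<gamma> where "\<forall>x'\<in>box n x \<gamma>. P x'" using assms(2) by (auto simp: eventually_near)
  moreover have "x \<in> box n x \<gamma>" using assms(1) by (simp add: box_def)
  ultimately show thesis using that openin_box by blast
qed

lemma openin_near:
  assumes "B \<subseteq> Kpow n" "S \<subseteq> B" "\<And>x. x \<in> S \<Longrightarrow> eventually (\<lambda>x'. x' \<in> B \<longrightarrow> x' \<in> S) (near n x)"
  shows "openin (subtopology (Kpow_topology v n) B) S"
  unfolding openin_subtopology
proof (intro exI conjI)
  let ?W = "\<Union>{W. openin (Kpow_topology v n) W \<and> W \<inter> B \<subseteq> S}"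
  show "openin (Kpow_topology v n) ?W" by (rule openin_Union) blast
  show "S = ?W \<inter> B"
  proof
    show "S \<subseteq> ?W \<inter> B"
    proof
      fix x assume x: "x \<in> S"
      with assms obtain W where "openin (Kpow_topology v n) W" "x \<in> W" "\<forall>x'\<in>W. x' \<in> B \<longrightarrow> x' \<in> S"
        using eventually_near_open[OF _ assms(3)[OF x]] by blast
      then show "x \<in> ?W \<inter> B" using x assms by blast
    qed
  qed blast
qed

lemma continuous_map_near:
  assumes "B \<subseteq> Kpow n"
    and "\<And>x \<gamma>. x \<in> B \<Longrightarrow> eventually (\<lambda>x'. x' \<in> B \<longrightarrow> Fin \<gamma> < v (h x' - h x)) (near n x)"
  shows "continuous_map (subtopology (Kpow_topology v n) B) (K_topology v) h"
proof -
  have B: "Kpow n \<inter> B = B" using assms(1) by blast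
  have "openin (subtopology (Kpow_topology v n) B) {x \<in> B. h x \<in> U}" if U: "openin (K_topology v) U" for U
  proof (rule openin_near[OF assms(1)])
    fix x assume x: "x \<in> {x \<in> B. h x \<in> U}"
    then obtain \<gamma> where \<gamma>: "{y. Fin \<gamma> < v (y - h x)} \<subseteq> U"
      using U unfolding openin_K_topology by blast
    have "eventually (\<lambda>x'. x' \<in> B \<longrightarrow> Fin \<gamma> < v (h x' - h x)) (near n x)" using assms(2) x by blast
    then show "eventually (\<lambda>x'. x' \<in> B \<longrightarrow> x' \<in> {x \<in> B. h x \<in> U}) (near n x)"
      by (rule eventually_mono) (use \<gamma> in blast)
  qed blast
  then show ?thesis by (simp add: continuous_map_def B)
qed

lemma vtends_eval_k:
  assumes "\<And>i. vtends F (\<lambda>x. x i) (x0 i)"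
  shows "vtends F (\<lambda>x. eval_k x t) (eval_k x0 t)"
  by (induction t) (auto intro: assms vtends_add vtends_mult vtends_minus)

lemma vtends_near:
  "vtends (near n x) (\<lambda>x'. eval_k (with_params n a x') t) (eval_k (with_params n a x) t)"
proof -
  have "vtends (filtermap (with_params n a) (near n x)) (\<lambda>x. x i) (with_params n a x i)" for i
    unfolding vtends_filtermap
    by (cases "i < n") (auto simp: vtends_def eventually_near box_def)
  from vtends_eval_k[OF this] show ?thesis by (simp add: vtends_filtermap)
qed

lemma eventually_near_neq_0:
  assumes "eval_k (with_params n a x) t \<noteq> 0"
  shows "eventually (\<lambda>x'. v (eval_k (with_params n a x) t) <
           v (eval_k (with_params n a x) t - eval_k (with_params n a x') t)) (near n x)"
proof -
  obtain \<gamma> where "v (eval_k (with_params n a x) t) = Fin \<gamma>"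
    using assms by (metis v_eq_Infty_iff vinf.exhaust)
  then show ?thesis
    using vtends_near[of n x a t] by (simp add: vtends_def v_minus_commute)
qed

text \<open>\<open>U\<close> records which terms of \<open>T\<close> vanish. Nonvanishing is open
  and vanishing is closed, so for finite \<open>T\<close> a cell is locally closed, and on it no
  term of \<open>T\<close> passes between zero and nonzero.\<close>

definition cell :: "nat \<Rightarrow> (nat \<Rightarrow> 'k) \<Rightarrow> kterm set \<Rightarrow> kterm set \<Rightarrow> (nat \<Rightarrow> 'k) set" where
  "cell n a T U = {x \<in> Kpow n. \<forall>t\<in>T. eval_k (with_params n a x) t = 0 \<longleftrightarrow> t \<in> U}"

lemma openin_nonzero: "openin (Kpow_topology v n) {x \<in> Kpow n. eval_k (with_params n a x) t \<noteq> 0}"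
proof -
  have "openin (subtopology (Kpow_topology v n) (Kpow n)) {x \<in> Kpow n. eval_k (with_params n a x) t \<noteq> 0}"
  proof (rule openin_near)
    fix x assume "x \<in> {x \<in> Kpow n. eval_k (with_params n a x) t \<noteq> 0}"
    then have "eventually (\<lambda>x'. v (eval_k (with_params n a x) t) <
           v (eval_k (with_params n a x) t - eval_k (with_params n a x') t)) (near n x)"
      by (intro eventually_near_neq_0) simp
    then show "eventually (\<lambda>x'. x' \<in> Kpow n \<longrightarrow>
        x' \<in> {x \<in> Kpow n. eval_k (with_params n a x) t \<noteq> 0}) (near n x)"
      by (rule eventually_mono) auto
  qed auto
  then show ?thesis by (simp add: subtopology_topspace[of "Kpow_topology v n", simplified])
qed

lemma cell_eq_open_closed:
  assumes "finite T"
  obtains V C where "openin (Kpow_topology v n) V" "closedin (Kpow_topology v n) C" "cell n a T U = V \<inter> C"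
proof -
  let ?N = "\<lambda>t. {x \<in> Kpow n. eval_k (with_params n a x) t \<noteq> 0}"
  \<comment> \<open>\<open>Kpow n\<close> is inserted so that an empty family of conditions gives
    the whole space and not \<open>UNIV\<close>.\<close>
  define V where "V = \<Inter> (insert (Kpow n) (?N ` (T - U)))"
  define C where "C = Kpow n - (\<Union>t\<in>T \<inter> U. ?N t)"
  have "openin (Kpow_topology v n) (Kpow n)"
    using openin_topspace[of "Kpow_topology v n"] by simp
  then have "openin (Kpow_topology v n) V"
    unfolding V_def using assms openin_nonzero by (intro openin_Inter) auto
  moreover have "openin (Kpow_topology v n) (\<Union>t\<in>T \<inter> U. ?N t)"
    using openin_nonzero by (intro openin_Union) blast
  then have "closedin (Kpow_topology v n) C"
    unfolding C_def by (simp only: openin_closedin_eq topspace_Kpow_topology)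
  moreover have "cell n a T U = V \<inter> C"
    by (auto simp: cell_def V_def C_def)
  ultimately show thesis by (rule that)
qed

lemma locally_closed_in_cell:
  assumes "finite T" "openin (subtopology (Kpow_topology v n) (cell n a T U)) S"
  shows "locally_closed_in (Kpow_topology v n) S"
proof -
  obtain V C where VC: "openin (Kpow_topology v n) V" "closedin (Kpow_topology v n) C"
    "cell n a T U = V \<inter> C" using cell_eq_open_closed[OF assms(1)] .
  obtain W where "openin (Kpow_topology v n) W" "S = W \<inter> cell n a T U"
    using assms(2) by (auto simp: openin_subtopology)
  then have "openin (Kpow_topology v n) (W \<inter> V)" "S = (W \<inter> V) \<inter> C" using VC by auto
  with VC(2) show ?thesis unfolding locally_closed_in_def by blast
qed

end

primrec conj_list :: "('gf, 'gp, 'rf, 'rp) formula list \<Rightarrow> ('gf, 'gp, 'rf, 'rp) formula" where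
  "conj_list [] = KEq KZero KZero"
| "conj_list (\<phi> # \<phi>s) = Conj \<phi> (conj_list \<phi>s)"

lemma sat_conj_list: "sat M x g r (conj_list \<phi>s) \<longleftrightarrow> (\<forall>\<phi>\<in>set \<phi>s. sat M x g r \<phi>)"
  by (induction \<phi>s) auto

context henselian_pas
begin

lemma ex_formula_zero_pattern:
  assumes "finite T"
  obtains \<psi> :: "('gf, 'gp, 'rf, 'rp) formula"
  where "\<And>x g r. sat M x g r \<psi> \<longleftrightarrow> (\<forall>t\<in>T. eval_k x t = 0 \<longleftrightarrow> t \<in> U)"
proof -
  obtain ts where ts: "set ts = T" using finite_list[OF assms] by blast
  define lit :: "kterm \<Rightarrow> ('gf, 'gp, 'rf, 'rp) formula"
    where "lit t = (if t \<in> U then KEq t KZero else Neg (KEq t KZero))" for t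
  have "sat M x g r (lit t) \<longleftrightarrow> (eval_k x t = 0 \<longleftrightarrow> t \<in> U)" for x g r t
    by (simp add: lit_def)
  then have "sat M x g r (conj_list (map lit ts)) \<longleftrightarrow> (\<forall>t\<in>T. eval_k x t = 0 \<longleftrightarrow> t \<in> U)" for x g r
    by (simp add: sat_conj_list ts)
  then show thesis by (rule that)
qed

text \<open>A nonzero value keeps its leading term nearby; a zero value need not, but the cell
  forces it to remain zero.\<close>

lemma eventually_same_rv_near:
  assumes "finite T" "x \<in> cell n a T U"
  shows "eventually (\<lambda>x'. x' \<in> cell n a T U \<longrightarrow>
           same_rv T (with_params n a x) (with_params n a x')) (near n x)"
proof -
  have "eventually (\<lambda>x'. x' \<in> cell n a T U \<longrightarrow>
      rv_eq (eval_k (with_params n a x) t) (eval_k (with_params n a x') t)) (near n x)"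
    if t: "t \<in> T" for t
  proof (cases "t \<in> U")
    case True
    then show ?thesis using assms(2) t by (auto simp: cell_def intro!: always_eventually)
  next
    case False
    then have "eval_k (with_params n a x) t \<noteq> 0" using assms(2) t by (auto simp: cell_def)
    from eventually_near_neq_0[OF this] show ?thesis
      by (rule eventually_mono) (simp add: rv_eq_def)
  qed
  then have "eventually (\<lambda>x'. \<forall>t\<in>T. x' \<in> cell n a T U \<longrightarrow>
      rv_eq (eval_k (with_params n a x) t) (eval_k (with_params n a x') t)) (near n x)"
    using assms(1) by (intro eventually_ball_finite ballI)
  then show ?thesis by (rule eventually_mono) (simp add: same_rv_def)
qed

lemma R_tends_near: "R_tends (filtermap (with_params n a) (near n x)) (with_params n a x)"
  unfolding R_tends_def by (auto simp: kterm_funs_def vtends_filtermap vtends_near)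

lemma R_tends_mono: "R_tends F x \<Longrightarrow> F' \<le> F \<Longrightarrow> R_tends F' x"
  unfolding R_tends_def vtends_def using filter_leD by blast

theorem piecewise_continuous:
  fixes \<phi> :: "('gf, 'gp, 'rf, 'rp) formula"
  assumes S: "S \<subseteq> Kpow n"
    and graph: "\<And>x y. x \<in> Kpow n \<Longrightarrow>
      sat M ((with_params n a x)(n := y)) g r \<phi> \<longleftrightarrow> x \<in> S \<and> h x = y"
  shows "\<exists>P. finite P \<and> partition_on S P \<and>
    (\<forall>B\<in>P. definable M n B \<and> locally_closed_in (Kpow_topology v n) B \<and>
       continuous_map (subtopology (Kpow_topology v n) B) (K_topology v) h)"
proof -
  obtain T0 where T0: "finite T0" "\<And>x x' g r. same_rv T0 x x' \<Longrightarrow> sat M x g r \<phi> = sat M x' g r \<phi>"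
    using sat_same_rv[of \<phi>] by blast
  obtain T where T: "finite T" and
    lift: "\<And>x y. \<exists>Y. (\<forall>x'. same_rv T x x' \<longrightarrow> same_rv T0 (x(n := y)) (x'(n := Y x'))) \<and>
       (\<forall>F. R_tends F x \<longrightarrow> eventually (same_rv T x) F \<longrightarrow> vtends F Y y)"
    using kterm_lifting[OF T0(1), of n] by blast
  have key: "eventually (\<lambda>x'. x' \<in> cell n a T U \<longrightarrow> x' \<in> S \<and> Fin \<gamma> < v (h x' - h x)) (near n x)"
    if x: "x \<in> S" "x \<in> cell n a T U" for x \<gamma> U
  proof -
    let ?w = "with_params n a"
    let ?C = "cell n a T U"
    obtain Y where Y: "\<And>x'. same_rv T (?w x) x' \<Longrightarrow> same_rv T0 ((?w x)(n := h x)) (x'(n := Y x'))"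
      and tends: "\<And>F. R_tends F (?w x) \<Longrightarrow> eventually (same_rv T (?w x)) F \<Longrightarrow> vtends F Y (h x)"
      using lift[of "?w x" "h x"] by blast
    have near: "eventually (\<lambda>x'. x' \<in> ?C \<longrightarrow> same_rv T (?w x) (?w x')) (near n x)"
      by (rule eventually_same_rv_near[OF T x(2)])
    \<comment> \<open>The filter is cut down to the cell, where the leading terms are known to agree
      with those at \<open>x\<close>.\<close>
    let ?F = "filtermap ?w (inf (near n x) (principal ?C))"
    have "R_tends ?F (?w x)"
      by (rule R_tends_mono[OF R_tends_near]) (intro filtermap_mono inf_le1)
    moreover have "eventually (same_rv T (?w x)) ?F"
      using near by (simp add: eventually_filtermap eventually_inf_principal)
    ultimately have "vtends ?F Y (h x)" by (rule tends)
    then have "eventually (\<lambda>x'. x' \<in> ?C \<longrightarrow> Fin \<gamma> < v (Y (?w x') - h x)) (near n x)"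
      by (simp add: vtends_def eventually_filtermap eventually_inf_principal)
    with near show ?thesis
    proof eventually_elim
      case (elim x')
      show ?case
      proof
        assume x': "x' \<in> ?C"
        then have K: "x' \<in> Kpow n" "x \<in> Kpow n" using S x by (auto simp: cell_def)
        have "sat M ((?w x)(n := h x)) g r \<phi>" using graph[OF K(2)] x(1) by simp
        then have "sat M ((?w x')(n := Y (?w x'))) g r \<phi>"
          using T0(2)[OF Y] elim(1) x' by blast
        then have "x' \<in> S \<and> h x' = Y (?w x')" using graph[OF K(1)] by simp
        then show "x' \<in> S \<and> Fin \<gamma> < v (h x' - h x)" using elim(2) x' by simp
      qed
    qed
  qed
  \<comment> \<open>Some vanishing patterns may not occur on \<open>S\<close>; a partition has no
    empty block.\<close>
  define P where "P = (\<lambda>U. S \<inter> cell n a T U) ` Pow T - {{}}"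
  have "finite P" using T by (simp add: P_def)
  moreover have "partition_on S P"
  proof (rule partition_onI)
    show "\<Union> P = S"
    proof
      show "S \<subseteq> \<Union> P"
      proof
        fix x assume x: "x \<in> S"
        define U where "U = {t \<in> T. eval_k (with_params n a x) t = 0}"
        have "x \<in> S \<inter> cell n a T U" using x S by (auto simp: cell_def U_def)
        moreover have "U \<in> Pow T" by (auto simp: U_def)
        ultimately show "x \<in> \<Union> P" unfolding P_def by blast
      qed
    qed (auto simp: P_def)
  next
    fix B B' assume "B \<in> P" "B' \<in> P" "B \<noteq> B'"
    then obtain U U' where U: "U \<subseteq> T" "U' \<subseteq> T" "B = S \<inter> cell n a T U" "B' = S \<inter> cell n a T U'" "U \<noteq> U'"
      unfolding P_def by blast
    then obtain t where "t \<in> T" "t \<in> U \<longleftrightarrow> t \<notin> U'" by blast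
    then have "cell n a T U \<inter> cell n a T U' = {}" unfolding cell_def by blast
    then show "disjnt B B'" using U by (auto simp: disjnt_def)
  qed (simp add: P_def)
  moreover have "definable M n B \<and> locally_closed_in (Kpow_topology v n) B \<and>
       continuous_map (subtopology (Kpow_topology v n) B) (K_topology v) h" if BP: "B \<in> P" for B
  proof -
    obtain U where B: "B = S \<inter> cell n a T U" using BP unfolding P_def by blast
    obtain \<psi> :: "('gf, 'gp, 'rf, 'rp) formula"
      where \<psi>: "\<And>x g r. sat M x g r \<psi> \<longleftrightarrow> (\<forall>t\<in>T. eval_k x t = 0 \<longleftrightarrow> t \<in> U)"
      using ex_formula_zero_pattern[OF T, of U] by blast
    \<comment> \<open>\<open>KEx n \<phi>\<close> defines the domain \<open>S\<close> of the graph,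
      and the parameters of the graph serve the vanishing pattern as well.\<close>
    have "B = {x \<in> Kpow n. sat M (with_params n a x) g r (Conj (KEx n \<phi>) \<psi>)}"
      using S graph by (auto simp: B cell_def \<psi> simp del: fun_upd_apply)
    then have "definable M n B" unfolding definable_def by blast
    moreover have "openin (subtopology (Kpow_topology v n) (cell n a T U)) B"
    proof (rule openin_near)
      fix x assume "x \<in> B"
      then have "x \<in> S" "x \<in> cell n a T U" by (auto simp: B)
      \<comment> \<open>The radius 0 is arbitrary: only membership in \<open>S\<close> is read
        off.\<close>
      from key[OF this, of 0] show "eventually (\<lambda>x'. x' \<in> cell n a T U \<longrightarrow> x' \<in> B) (near n x)"
        by (rule eventually_mono) (simp add: B)
    qed (auto simp: B cell_def)
    then have "locally_closed_in (Kpow_topology v n) B" by (rule locally_closed_in_cell[OF T])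
    moreover have "continuous_map (subtopology (Kpow_topology v n) B) (K_topology v) h"
    proof (rule continuous_map_near)
      show "B \<subseteq> Kpow n" using S by (auto simp: B)
      fix x \<gamma> assume "x \<in> B"
      then have "x \<in> S" "x \<in> cell n a T U" by (auto simp: B)
      from key[OF this, of \<gamma>] show "eventually (\<lambda>x'. x' \<in> B \<longrightarrow> Fin \<gamma> < v (h x' - h x)) (near n x)"
        by (rule eventually_mono) (simp add: B)
    qed
    ultimately show ?thesis by blast
  qed
  ultimately show ?thesis by (intro exI[of _ P] conjI ballI) blast+
qed

text \<open>A point of \<open>Kpow (Suc n)\<close> is a point \<open>x\<close> of
  \<open>Kpow n\<close> with variable \<open>n\<close> set to \<open>y\<close>; this gives the graph
  in a chart the shape that \<open>piecewise_continuous\<close> expects.\<close>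

lemma graph_formula:
  assumes "definable_to_proj1 M n A f" "chart \<in> {chart0, chart1}"
  shows "\<exists>(\<phi> :: ('gf, 'gp, 'rf, 'rp) formula) a g r. \<forall>x\<in>Kpow n. \<forall>y.
    sat M ((with_params n a x)(n := y)) g r \<phi> \<longleftrightarrow> x \<in> A \<and> f x = chart y"
proof -
  have "definable M (Suc n) {z \<in> Kpow (Suc n). (restrict z {..<n}, chart (z n)) \<in> {(x, f x) |x. x \<in> A}}"
    using assms unfolding definable_to_proj1_def definable_in_Kpow_proj1_def by blast
  then obtain \<phi> :: "('gf, 'gp, 'rf, 'rp) formula" and a g r where
    eq: "{z \<in> Kpow (Suc n). (restrict z {..<n}, chart (z n)) \<in> {(x, f x) |x. x \<in> A}} =
      {z \<in> Kpow (Suc n). sat M (with_params (Suc n) a z) g r \<phi>}"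
    unfolding definable_def by blast
  have "sat M ((with_params n a x)(n := y)) g r \<phi> \<longleftrightarrow> x \<in> A \<and> f x = chart y" if x: "x \<in> Kpow n" for x y
  proof -
    let ?z = "x(n := y)"
    have z: "?z \<in> Kpow (Suc n)" using x by (auto simp: Kpow_def PiE_def extensional_def)
    have "restrict ?z {..<n} = x"
      using x by (auto simp: Kpow_def PiE_def extensional_def restrict_def)
    moreover have "with_params (Suc n) a ?z = (with_params n a x)(n := y)" by auto
    ultimately show ?thesis using eq z by (auto simp: set_eq_iff dest!: spec[of _ ?z])
  qed
  then show ?thesis by blast
qed

end

section \<open>Functions into the projective line\<close>

lemma continuous_map_chart0: "continuous_map (K_topology v) (proj1_topology v) chart0"
  by (auto simp: continuous_map_def openin_proj1_topology vimage_def)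

theorem theorem9p1:
  fixes M :: "('k::field, 'g::linordered_ab_group_add, 'r::field_char_0, 'gf, 'gp, 'rf, 'rp) pas_structure"
    and res :: "'k \<Rightarrow> 'r"
    and n :: nat
    and A :: "(nat \<Rightarrow> 'k) set"
    and f :: "(nat \<Rightarrow> 'k) \<Rightarrow> 'k proj1"
  assumes "valuation (val M)"
    and "henselian (val M)"
    and "residue_map (val M) res"
    and "angular_component (val M) res (ac M)"
    and "A \<subseteq> Kpow n"
    and "definable_to_proj1 M n A f"
  shows "\<exists>P. finite P \<and> partition_on A P \<and>
           (\<forall>B\<in>P. definable M n B \<and>
                  locally_closed_in (Kpow_topology (val M) n) B \<and>
                  continuous_map (subtopology (Kpow_topology (val M) n) B)
                                 (proj1_topology (val M)) f)"
proof -
  interpret henselian_pas M res using assms by unfold_locales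
  \<comment> \<open>\<open>chart0\<close> misses only \<open>chart1 0\<close>, the point at
    infinity. On \<open>S0\<close> the function is \<open>chart0\<close> of a
    \<open>K\<close>-valued function, on \<open>S1\<close> it is constant.\<close>
  define S0 where "S0 = {x \<in> A. f x \<in> range chart0}"
  define S1 where "S1 = {x \<in> A. f x = chart1 0}"
  have S: "S0 \<subseteq> Kpow n" "S1 \<subseteq> Kpow n" using assms(5) by (auto simp: S0_def S1_def)
  have "chart1 0 \<noteq> chart0 t" for t :: 'k
    using charts_transition[of t 0] by auto
  then have S0_S1: "S0 \<inter> S1 = {}" by (auto simp: S0_def S1_def)
  have "f x \<in> range chart0 \<or> f x = chart1 0" for x
  proof (cases "f x \<in> range chart0")
    case False
    then obtain t where t: "f x = chart1 t" using charts_cover by blast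
    have "t = 0"
    proof (rule ccontr)
      assume "t \<noteq> 0"
      then have "f x = chart0 (inverse t)" unfolding t by (intro charts_transition[THEN iffD2, symmetric]) simp
      with False show False by blast
    qed
    with t show ?thesis by simp
  qed simp
  then have A: "A = S0 \<union> S1" by (auto simp: S0_def S1_def)
  define h where "h x = inv chart0 (f x)" for x
  have f_eq: "f x = chart0 (h x)" if "x \<in> S0" for x
    using that by (simp add: h_def S0_def f_inv_into_f)

  obtain \<phi> :: "('gf, 'gp, 'rf, 'rp) formula" and a g r where \<phi>: "\<forall>x\<in>Kpow n. \<forall>y.
    sat M ((with_params n a x)(n := y)) g r \<phi> \<longleftrightarrow> x \<in> A \<and> f x = chart0 y"
    using graph_formula[OF assms(6), of chart0] by (simp, blast)
  have inv: "inv chart0 (chart0 y) = y" for y :: 'k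
    by (rule inv_f_f[OF inj_charts(1)])
  have graph0: "sat M ((with_params n a x)(n := y)) g r \<phi> \<longleftrightarrow> x \<in> S0 \<and> h x = y" if "x \<in> Kpow n" for x y
    unfolding \<phi>[rule_format, OF that] by (auto simp: S0_def h_def inv)
  obtain P0 where P0: "finite P0" "partition_on S0 P0"
    "\<forall>B\<in>P0. definable M n B \<and> locally_closed_in (Kpow_topology v n) B \<and>
       continuous_map (subtopology (Kpow_topology v n) B) (K_topology v) h"
    using piecewise_continuous[OF S(1) graph0] by blast

  obtain \<phi>' :: "('gf, 'gp, 'rf, 'rp) formula" and a' g' r' where \<phi>': "\<forall>x\<in>Kpow n. \<forall>y.
    sat M ((with_params n a' x)(n := y)) g' r' \<phi>' \<longleftrightarrow> x \<in> A \<and> f x = chart1 y"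
    using graph_formula[OF assms(6), of chart1] by (simp, blast)
  \<comment> \<open>The added equation \<open>y = 0\<close> leaves the graph of the constant 0 over
    \<open>S1\<close>, so \<open>piecewise_continuous\<close> cuts \<open>S1\<close> into definable
    locally closed pieces.\<close>
  have graph1: "sat M ((with_params n a' x)(n := y)) g' r' (Conj \<phi>' (KEq (KVar n) KZero)) \<longleftrightarrow>
      x \<in> S1 \<and> 0 = y" if "x \<in> Kpow n" for x y
    using \<phi>'[rule_format, OF that, of y] by (auto simp: S1_def)
  obtain P1 where P1: "finite P1" "partition_on S1 P1"
    "\<forall>B\<in>P1. definable M n B \<and> locally_closed_in (Kpow_topology v n) B"
    using piecewise_continuous[OF S(2) graph1] by blast

  have cont0: "continuous_map (subtopology (Kpow_topology v n) B) (proj1_topology v) f" if "B \<in> P0" for B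
  proof (rule continuous_map_eq)
    show "continuous_map (subtopology (Kpow_topology v n) B) (proj1_topology v) (chart0 \<circ> h)"
      using P0(3) that continuous_map_chart0 by (blast intro: continuous_map_compose)
    have "B \<subseteq> S0" using P0(2) that by (auto simp: partition_on_def)
    then show "(chart0 \<circ> h) x = f x" if "x \<in> topspace (subtopology (Kpow_topology v n) B)" for x
      using that f_eq[of x] by auto
  qed
  have cont1: "continuous_map (subtopology (Kpow_topology v n) B) (proj1_topology v) f" if "B \<in> P1" for B
  proof (rule continuous_map_eq)
    show "continuous_map (subtopology (Kpow_topology v n) B) (proj1_topology v) (\<lambda>_. chart1 0)"
      by simp
    have "B \<subseteq> S1" using P1(2) that by (auto simp: partition_on_def)
    then show "chart1 0 = f x" if "x \<in> topspace (subtopology (Kpow_topology v n) B)" for x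
      using that by (auto simp: S1_def)
  qed
  have "partition_on A (P0 \<union> P1)"
    unfolding A using P0(2) P1(2) S0_S1
    by (auto simp: partition_on_def disjoint_union)
  then show ?thesis
    using P0 P1 cont0 cont1 by (intro exI[of _ "P0 \<union> P1"]) auto
qed

end
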